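(* Let $\vec X^m\in\underline V^h_{\partial_0}$ satisfy assumptions $(\mathfrak A)$ and $(\mathfrak B)^h$, and let $\Delta t_m>0$. Then there exists a unique pair $(\delta\vec X^{m+1},\kappa^{m+1})\in\underline V^h_\partial\times V^h$ such that, with $\vec X^{m+1}=\vec X^m+\delta\vec X^{m+1}$, $$\Big(\tfrac{\vec X^{m+1}-\vec X^m}{\Delta t_m},\chi\,\vec\nu^m|\vec X^m_\rho|\Big)^h=\Big(\kappa^{m+1}-\mathfrak K^m(\kappa^{m+1}),\chi\,|\vec X^m_\rho|\Big)^h\quad\forall\,\chi\in V^h,$$ $$\Big(\kappa^{m+1}\vec\nu^m,\vec\eta\,|\vec X^m_\rho|\Big)^h+\Big(\vec X^{m+1}_\rho,\vec\eta_\rho|\vec X^m_\rho|^{-1}\Big)=-\sum_{i=1}^2\sum_{p\in\partial_iI}\widehat\varrho^{(p)}\,\vec\eta(p)\cdot\vec e_{3-i}\quad\forall\,\vec\eta\in\underline V^h_\partial .$$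
   Context: Setup. $\vec e_1=(1,0)^T$, $\vec e_2=(0,1)^T$; "$\cdot$" is the Euclidean inner product. $I$ is either the periodic interval $\mathbb R/\mathbb Z$ (with $\partial I=\emptyset$) or $I=(0,1)$ (with $\partial I=\{0,1\}$). $\partial I=\partial_DI\cup\partial_0I\cup\partial_1I\cup\partial_2I$ is a given disjoint partition, and $\widehat\varrho^{(p)}\in\mathbb R$, $p\in\{0,1\}$, are given constants with $|\widehat\varrho^{(p)}|\le1$. Let $J\ge3$, $h=1/J$, $q_j=jh$ ($j=0,\dots,J$; $q_0=q_J$ identified in the periodic case). $V^h$ is the space of continuous functions on $\overline I$ (periodic if $I=\mathbb R/\mathbb Z$) that are affine on each $[q_{j-1},q_j]$; $\underline V^h=[V^h]^2$; $\underline V^h_{\partial_0}=\{\vec\eta\in\underline V^h:\vec\eta(\rho)\cdot\vec e_1=0\ \forall\rho\in\partial_0I\}$; $\underline V^h_\partial=\{\vec\eta\in\underline V^h_{\partial_0}:\vec\eta(\rho)\cdot\vec e_i=0\ \forall\rho\in\partial_iI,\ i=1,2;\ \vec\eta(\rho)=\vec0\ \forall\rho\in\partial_DI\}$. $(\cdot,\cdot)$ is the $L^2(I)$ inner product (with dot product for vector functions), and for piecewise continuous $f,g$ (possibly discontinuous at nodes) the mass-lumped product is $(f,g)^h=\tfrac h2\sum_{j=1}^J[(fg)(q_j^-)+(fg)(q_{j-1}^+)]$. For $\vec X^m\in\underline V^h_{\partial_0}$ with $|\vec X^m_\rho|>0$ a.e., set $\vec\nu^m=-[\vec X^m_\rho]^\perp/|\vec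 X^m_\rho|$, where $(a,b)^\perp=(b,-a)$, and let $\vec\omega^m\in\underline V^h$ be defined by $(\vec\omega^m,\vec\varphi|\vec X^m_\rho|)^h=(\vec\nu^m,\vec\varphi|\vec X^m_\rho|)$ for all $\vec\varphi\in\underline V^h$. Assumption $(\mathfrak A)$: $|\vec X^m_\rho|>0$ a.e. on $I$ and $\vec X^m(\rho)\cdot\vec e_1>0$ for all $\rho\in\overline I\setminus\partial_0I$. Assumption $(\mathfrak B)^h$: the set $\{(\vec\nu^m,\chi|\vec X^m_\rho|)^h:\chi\in V^h\}\subset\mathbb R^2$ spans $\mathbb R^2$. For $\kappa\in V^h$, $\mathfrak K^m(\kappa)\in V^h$ is defined nodally by $\mathfrak K^m(\kappa)(q_j)=\frac{\vec\omega^m(q_j)\cdot\vec e_1}{\vec X^m(q_j)\cdot\vec e_1}$ if $q_j\in\overline I\setminus\partial_0I$ and $\mathfrak K^m(\kappa)(q_j)=-\kappa(q_j)$ if $q_j\in\partial_0I$. *)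

theory Defs
  imports "HOL-Analysis.Analysis"
begin

text \<open>The flag per selects I = R/Z (per = True) or I = (0,1) (per = False).\<close>

definition bdryI :: "bool \<Rightarrow> real set" where
  "bdryI per = (if per then {} else {0, 1})"

definition meshsize :: "nat \<Rightarrow> real" where
  "meshsize J = 1 / real J"

definition node :: "nat \<Rightarrow> nat \<Rightarrow> real" where
  "node J j = real j / real J"

definition e1 :: "real^2" where "e1 = axis 1 1"
definition e2 :: "real^2" where "e2 = axis 2 1"

definition perp :: "real^2 \<Rightarrow> real^2" where
  "perp v = (\<chi> i. if i = 1 then v $ 2 else - (v $ 1))"

text \<open>Elements of V^h are represented as functions real => real that vanish outside
  the closure [0,1] of I (a normalisation convention making equality of FE functions
  coincide with equality in HOL); in the periodic case f 0 = f 1 (q_0 = q_J identified).\<close>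

definition Vh :: "bool \<Rightarrow> nat \<Rightarrow> (real \<Rightarrow> real) set" where
  "Vh per J = {f. (\<forall>x. x \<notin> {0..1} \<longrightarrow> f x = 0)
      \<and> continuous_on {0..1} f
      \<and> (\<forall>j\<in>{1..J}. \<exists>a b. \<forall>x\<in>{node J (j - 1)..node J j}. f x = a * x + b)
      \<and> (per \<longrightarrow> f 0 = f 1)}"

definition VVh :: "bool \<Rightarrow> nat \<Rightarrow> (real \<Rightarrow> real^2) set" where
  "VVh per J = {f. (\<lambda>x. f x $ 1) \<in> Vh per J \<and> (\<lambda>x. f x $ 2) \<in> Vh per J}"

definition VVh0 :: "bool \<Rightarrow> nat \<Rightarrow> real set \<Rightarrow> (real \<Rightarrow> real^2) set" where
  "VVh0 per J P0 = {f \<in> VVh per J. \<forall>\<rho>\<in>P0. f \<rho> \<bullet> e1 = 0}"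

definition VVhB :: "bool \<Rightarrow> nat \<Rightarrow> real set \<Rightarrow> real set \<Rightarrow> real set \<Rightarrow> real set
    \<Rightarrow> (real \<Rightarrow> real^2) set" where
  "VVhB per J D P0 P1 P2 = {f \<in> VVh0 per J P0.
      (\<forall>\<rho>\<in>P1. f \<rho> \<bullet> e1 = 0) \<and> (\<forall>\<rho>\<in>P2. f \<rho> \<bullet> e2 = 0) \<and> (\<forall>\<rho>\<in>D. f \<rho> = 0)}"

definition drho :: "(real \<Rightarrow> real^2) \<Rightarrow> real \<Rightarrow> real^2" where
  "drho f x = vector_derivative f (at x)"

text \<open>L2(I) inner product of (already multiplied) integrand F = f g.\<close>
definition L2 :: "(real \<Rightarrow> real) \<Rightarrow> real" where
  "L2 F = integral {0..1} F"

text \<open>Mass-lumped quantity for the product F = f g of piecewise continuous functions: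
  (f,g)^h = h/2 sum_j [(fg)(q_j^-) + (fg)(q_(j-1)^+)], one-sided values taken as
  one-sided limits.\<close>
definition lumped :: "nat \<Rightarrow> (real \<Rightarrow> 'a::real_normed_vector) \<Rightarrow> 'a" where
  "lumped J F = (meshsize J / 2) *\<^sub>R
     (\<Sum>j = 1..J. Lim (at_left (node J j)) F + Lim (at_right (node J (j - 1))) F)"

definition nu :: "(real \<Rightarrow> real^2) \<Rightarrow> real \<Rightarrow> real^2" where
  "nu X x = - ((1 / norm (drho X x)) *\<^sub>R perp (drho X x))"

definition omega :: "bool \<Rightarrow> nat \<Rightarrow> (real \<Rightarrow> real^2) \<Rightarrow> real \<Rightarrow> real^2" where
  "omega per J X = (THE w. w \<in> VVh per J \<and>
      (\<forall>\<phi>\<in>VVh per J.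
         lumped J (\<lambda>x. w x \<bullet> (norm (drho X x) *\<^sub>R \<phi> x))
           = L2 (\<lambda>x. nu X x \<bullet> (norm (drho X x) *\<^sub>R \<phi> x))))"

definition Kop :: "bool \<Rightarrow> nat \<Rightarrow> real set \<Rightarrow> (real \<Rightarrow> real^2) \<Rightarrow> (real \<Rightarrow> real)
    \<Rightarrow> real \<Rightarrow> real" where
  "Kop per J P0 X \<kappa> = (THE f. f \<in> Vh per J \<and> (\<forall>j\<le>J.
      f (node J j) = (if node J j \<in> P0 then - \<kappa> (node J j)
                      else (omega per J X (node J j) \<bullet> e1) / (X (node J j) \<bullet> e1))))"

definition assmA :: "bool \<Rightarrow> real set \<Rightarrow> (real \<Rightarrow> real^2) \<Rightarrow> bool" where
  "assmA per P0 X \<longleftrightarrow>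
     negligible {x \<in> {0<..<1}. \<not> (norm (drho X x) > 0)}
     \<and> (\<forall>\<rho>\<in>{0..1} - P0. X \<rho> \<bullet> e1 > 0)"

definition assmB :: "bool \<Rightarrow> nat \<Rightarrow> (real \<Rightarrow> real^2) \<Rightarrow> bool" where
  "assmB per J X \<longleftrightarrow>
     span {lumped J (\<lambda>x. (c x * norm (drho X x)) *\<^sub>R nu X x) | c. c \<in> Vh per J} = UNIV"

end

theory Submission
  imports Defs
begin

text \<open>In nodal coefficients the two equations form a square linear system, so that existence
  follows from uniqueness. For a solution of the homogeneous system, testing the first equation with
  \<open>\<kappa>\<close> and the second one with \<open>\<delta>X\<close> yields
  \<open>\<Delta>t (\<lambda> \<kappa>, \<kappa> |X\<^sub>\<rho>|)\<^sup>h + (|\<delta>X\<^sub>\<rho>|\<^sup>2, |X\<^sub>\<rho>|\<^sup>-\<^sup>1) = 0\<close>, where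
  \<open>\<lambda>\<close> is 2 at the nodes in \<open>\<partial>\<^sub>0I\<close> and 1 at all other nodes.
  Hence \<open>\<kappa> = 0\<close> and \<open>\<delta>X\<close> is a constant vector, which by the first equation is
  orthogonal to all \<open>(\<nu>, \<chi> |X\<^sub>\<rho>|)\<^sup>h\<close> and thus vanishes by assumption \<open>(B)\<^sup>h\<close>.\<close>

section \<open>Nondegenerate bilinear forms in finitely many coefficients\<close>

text \<open>Discrete functions live in a function type that is not finite-dimensional, and the trial
  space varies with \<open>per\<close>, \<open>J\<close> and the boundary partition. Coefficients
  are therefore functions supported in a finite index set: boundary conditions and the
  identification of the end nodes are encoded by leaving indices out. Trial and test functions share
  one index set, which makes the system square. The scheme is affine in \<kappa>, not linear. On
  \<open>P0\<close> the operator K equals minus \<kappa>, so that the difference is twice \<kappa>;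
  this sign is what keeps the quadratic form definite there. At other nodes K is independent of
  \<kappa> and becomes data. Since K refers to \<open>omega\<close>, which is given by a definite
  description, existence and uniqueness of \<open>omega\<close> have to be settled before the scheme
  can be written in coefficients.\<close>

lemma square_system_solvable:
  fixes A :: "'a \<Rightarrow> 'b \<Rightarrow> real"
  assumes "finite I" "finite K" "card I = card K"
    and "\<And>x. \<forall>i\<in>I. (\<Sum>k\<in>K. A i k * x k) = 0 \<Longrightarrow> \<forall>k\<in>K. x k = 0"
  shows "\<exists>x. \<forall>i\<in>I. (\<Sum>k\<in>K. A i k * x k) = b i"
  using assms
proof (induction "card K" arbitrary: I K A b)
  case 0
  then show ?case by auto
next
  case (Suc m)
  then obtain k0 where k0: "k0 \<in> K"
    by (metis card_eq_0_iff ex_in_conv nat.distinct(1))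
  have "\<exists>i0\<in>I. A i0 k0 \<noteq> 0"
  proof (rule ccontr)
    \<comment> \<open>A column without a pivot would put the unit vector at \<open>k0\<close> into
      the kernel.\<close>
    assume "\<not> ?thesis"
    then have "\<forall>i\<in>I. (\<Sum>k\<in>K. A i k * (if k = k0 then 1 else 0)) = 0"
      using Suc.prems(2) k0 by (simp add: if_distrib [of "(*) _"] cong: if_cong)
    from Suc.prems(4) [OF this] k0 show False by auto
  qed
  then obtain i0 where i0: "i0 \<in> I" "A i0 k0 \<noteq> 0" by blast
  define I' where "I' = I - {i0}"
  define K' where "K' = K - {k0}"
  define C where "C i k = A i k - A i k0 / A i0 k0 * A i0 k" for i k
  have split: "(\<Sum>k\<in>K. A i k * x k) = A i k0 * x k0 + (\<Sum>k\<in>K'. A i k * x k)" for i x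
    unfolding K'_def using Suc.prems(2) k0 by (rule sum.remove)
  have elim: "(\<Sum>k\<in>K'. C i k * x k)
      = (\<Sum>k\<in>K'. A i k * x k) - A i k0 / A i0 k0 * (\<Sum>k\<in>K'. A i0 k * x k)" for i x
    unfolding C_def by (simp add: left_diff_distrib sum_subtractf sum_distrib_left mult.assoc)
  \<comment> \<open>The pivot row determines the eliminated unknown from \<open>x\<close> and the
    right-hand side \<open>c\<close>. The case \<open>c = 0\<close> lifts kernel vectors of the
    reduced system, the case \<open>c = b i0\<close> lifts its solutions.\<close>
  have backsubst: "\<exists>y. (\<Sum>k\<in>K. A i0 k * y k) = c \<and> (\<forall>k\<in>K'. y k = x k) \<and>
      (\<forall>i\<in>I'. (\<Sum>k\<in>K. A i k * y k) = (\<Sum>k\<in>K'. C i k * x k) + A i k0 / A i0 k0 * c)" for x c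
  proof -
    define y where "y = x(k0 := (c - (\<Sum>k\<in>K'. A i0 k * x k)) / A i0 k0)"
    have *: "(\<Sum>k\<in>K'. A i k * y k) = (\<Sum>k\<in>K'. A i k * x k)" for i
      by (rule sum.cong) (auto simp: y_def K'_def)
    show ?thesis
    proof (intro exI [of _ y] conjI ballI)
      show "(\<Sum>k\<in>K. A i0 k * y k) = c"
        unfolding split * using i0 by (simp add: y_def)
      show "y k = x k" if "k \<in> K'" for k
        using that by (auto simp: y_def K'_def)
      show "(\<Sum>k\<in>K. A i k * y k) = (\<Sum>k\<in>K'. C i k * x k) + A i k0 / A i0 k0 * c" for i
        unfolding split * elim by (simp add: y_def algebra_simps diff_divide_distrib)
    qed
  qed
  have "\<exists>x. \<forall>i\<in>I'. (\<Sum>k\<in>K'. C i k * x k) = b i - A i k0 / A i0 k0 * b i0"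
  proof (rule Suc.hyps(1))
    show "m = card K'" "finite I'" "finite K'" "card I' = card K'"
      using Suc k0 i0 by (auto simp: I'_def K'_def)
    fix x assume x: "\<forall>i\<in>I'. (\<Sum>k\<in>K'. C i k * x k) = 0"
    obtain y where y: "(\<Sum>k\<in>K. A i0 k * y k) = 0" "\<forall>k\<in>K'. y k = x k"
      "\<forall>i\<in>I'. (\<Sum>k\<in>K. A i k * y k) = (\<Sum>k\<in>K'. C i k * x k)"
      using backsubst [of 0 x] by auto
    have "\<forall>i\<in>I. (\<Sum>k\<in>K. A i k * y k) = 0"
      using x y by (auto simp: I'_def)
    then have "\<forall>k\<in>K. y k = 0" by (rule Suc.prems(4))
    with y(2) show "\<forall>k\<in>K'. x k = 0" by (auto simp: K'_def)
  qed
  then obtain x where x: "\<forall>i\<in>I'. (\<Sum>k\<in>K'. C i k * x k) = b i - A i k0 / A i0 k0 * b i0" ..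
  obtain y where y: "(\<Sum>k\<in>K. A i0 k * y k) = b i0"
    "\<forall>i\<in>I'. (\<Sum>k\<in>K. A i k * y k) = (\<Sum>k\<in>K'. C i k * x k) + A i k0 / A i0 k0 * b i0"
    using backsubst [of "b i0" x] by auto
  then have "\<forall>i\<in>I. (\<Sum>k\<in>K. A i k * y k) = b i"
    using x by (auto simp: I'_def)
  then show ?case by blast
qed

section \<open>Linear functionals and bilinear forms on coefficients with finite support\<close>

definition supported_on :: "'i set \<Rightarrow> ('i \<Rightarrow> real) set" where
  "supported_on I = {x. \<forall>i. i \<notin> I \<longrightarrow> x i = 0}"

definition linear_functional :: "(('i \<Rightarrow> real) \<Rightarrow> real) \<Rightarrow> bool" where
  "linear_functional L \<longleftrightarrow> (\<forall>x y c. L (\<lambda>i. x i + c * y i) = L x + c * L y)"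

lemma linear_functional_expand:
  assumes L: "linear_functional L" and "finite I" and x: "x \<in> supported_on I"
  shows "L x = (\<Sum>k\<in>I. x k * L (\<lambda>i. if i = k then 1 else 0))"
proof -
  \<comment> \<open>The choice \<open>x = y = 0\<close>, \<open>c = 1\<close> reads
    \<open>L 0 = L 0 + L 0\<close>.\<close>
  have zero: "L (\<lambda>_. 0) = 0"
    using L [unfolded linear_functional_def, rule_format, of "\<lambda>_. 0" 1 "\<lambda>_. 0"] by simp
  have "L (\<lambda>i. \<Sum>k\<in>I. x k * (if i = k then 1 else 0))
      = (\<Sum>k\<in>I. x k * L (\<lambda>i. if i = k then 1 else 0))"
    using \<open>finite I\<close>
  proof (induction I)
    case empty
    show ?case by (simp add: zero)
  next
    case (insert k I)
    then show ?case
      using L [unfolded linear_functional_def, rule_format, of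
          "\<lambda>i. \<Sum>k\<in>I. x k * (if i = k then 1 else 0)" "x k" "\<lambda>i. if i = k then 1 else 0"]
      by (simp add: add.commute)
  qed
  moreover have "(\<lambda>i. \<Sum>k\<in>I. x k * (if i = k then 1 else 0)) = x"
    using x \<open>finite I\<close>
    by (auto simp: supported_on_def if_distrib [of "(*) _"] cong: if_cong)
  ultimately show ?thesis by simp
qed

text \<open>By linearity it suffices to test with unit vectors, which gives a square matrix with
  entries \<open>B (?e k) (?e i)\<close>. Nondegeneracy says that its kernel is trivial, hence
  solvability; applied to the difference of two solutions it gives uniqueness.\<close>

lemma nondegenerate_bilinear_unique_solution:
  fixes B :: "('i \<Rightarrow> real) \<Rightarrow> ('i \<Rightarrow> real) \<Rightarrow> real"
  assumes I: "finite I"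
    and left: "\<And>y. linear_functional (\<lambda>x. B x y)"
    and right: "\<And>x. linear_functional (B x)"
    and l: "linear_functional l"
    and nondeg: "\<And>x. x \<in> supported_on I \<Longrightarrow> \<forall>y\<in>supported_on I. B x y = 0 \<Longrightarrow> x = (\<lambda>_. 0)"
  shows "\<exists>!x. x \<in> supported_on I \<and> (\<forall>y\<in>supported_on I. B x y = l y)"
proof -
  let ?e = "\<lambda>k i. if i = k then 1 else (0::real)"
  have test: "(\<forall>y\<in>supported_on I. B x y = m y) \<longleftrightarrow> (\<forall>i\<in>I. B x (?e i) = m (?e i))"
    if m: "linear_functional m" for x m
  proof
    assume "\<forall>y\<in>supported_on I. B x y = m y"
    then show "\<forall>i\<in>I. B x (?e i) = m (?e i)" by (auto simp: supported_on_def)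
  next
    assume "\<forall>i\<in>I. B x (?e i) = m (?e i)"
    then show "\<forall>y\<in>supported_on I. B x y = m y"
      using linear_functional_expand [OF right I] linear_functional_expand [OF m I] by simp
  qed
  have zero: "linear_functional (\<lambda>_::'i \<Rightarrow> real. 0)" by (simp add: linear_functional_def)
  have "\<exists>x. \<forall>i\<in>I. (\<Sum>k\<in>I. B (?e k) (?e i) * x k) = l (?e i)"
  proof (rule square_system_solvable [OF I I refl])
    fix x assume x: "\<forall>i\<in>I. (\<Sum>k\<in>I. B (?e k) (?e i) * x k) = 0"
    \<comment> \<open>A kernel vector is arbitrary off \<open>I\<close>. Cutting it off preserves
      the sums over \<open>I\<close> and makes \<open>nondeg\<close> applicable.\<close>
    define x' where "x' = (\<lambda>i. if i \<in> I then x i else 0)"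
    have x': "x' \<in> supported_on I" by (simp add: x'_def supported_on_def)
    have "B x' (?e i) = (\<Sum>k\<in>I. B (?e k) (?e i) * x k)" for i
      unfolding linear_functional_expand [OF left I x']
      by (rule sum.cong) (auto simp: x'_def)
    then have "\<forall>y\<in>supported_on I. B x' y = 0"
      using x test [OF zero, of x'] by simp
    then have "x' = (\<lambda>_. 0)" using nondeg x' by blast
    then show "\<forall>k\<in>I. x k = 0" by (metis x'_def)
  qed
  then obtain x where x: "\<forall>i\<in>I. (\<Sum>k\<in>I. B (?e k) (?e i) * x k) = l (?e i)" ..
  define x' where "x' = (\<lambda>i. if i \<in> I then x i else 0)"
  have x': "x' \<in> supported_on I" by (simp add: x'_def supported_on_def)
  have "B x' (?e i) = (\<Sum>k\<in>I. B (?e k) (?e i) * x k)" for i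
    unfolding linear_functional_expand [OF left I x']
    by (rule sum.cong) (auto simp: x'_def)
  then have sol: "\<forall>y\<in>supported_on I. B x' y = l y"
    using x test [OF l, of x'] by simp
  have "z = x'" if z: "z \<in> supported_on I" "\<forall>y\<in>supported_on I. B z y = l y" for z
  proof -
    have "(\<lambda>i. z i + (- 1) * x' i) = (\<lambda>_. 0)"
    proof (rule nondeg)
      show "(\<lambda>i. z i + (- 1) * x' i) \<in> supported_on I"
        using z x' by (simp add: supported_on_def)
      have "B (\<lambda>i. z i + (- 1) * x' i) y = B z y + (- 1) * B x' y" for y
        using left unfolding linear_functional_def by blast
      then show "\<forall>y\<in>supported_on I. B (\<lambda>i. z i + (- 1) * x' i) y = 0"
        using z sol by simp
    qed
    then show ?thesis by (simp add: fun_eq_iff)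
  qed
  with x' sol show ?thesis by blast
qed

section \<open>Piecewise affine functions and quadrature\<close>

lemma node_0 [simp]: "node J 0 = 0"
  by (simp add: node_def)

lemma node_J [simp]: "0 < J \<Longrightarrow> node J J = 1"
  by (simp add: node_def)

lemma node_in_unit: "0 < J \<Longrightarrow> j \<le> J \<Longrightarrow> node J j \<in> {0..1}"
  by (simp add: node_def)

lemma node_diff: "0 < J \<Longrightarrow> 1 \<le> j \<Longrightarrow> node J j - node J (j - 1) = 1 / real J"
  by (simp add: node_def of_nat_diff field_simps)

lemma node_less: "0 < J \<Longrightarrow> 1 \<le> j \<Longrightarrow> node J (j - 1) < node J j"
  by (simp add: node_def divide_strict_right_mono)

lemma element_subset: "0 < J \<Longrightarrow> 1 \<le> j \<Longrightarrow> j \<le> J \<Longrightarrow> {node J (j - 1)..node J j} \<subseteq> {0..1}"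
  using node_in_unit [of J j] node_in_unit [of J "j - 1"] by auto

lemma unit_interval_elements:
  assumes "0 < J" "x \<in> {0..1}"
  shows "\<exists>j\<in>{1..J}. x \<in> {node J (j - 1)..node J j}"
\<comment> \<open>The ceiling of \<open>J * x\<close> is an admissible element index except at 0,
  where it would be 0.\<close>
proof (cases "x = 0")
  case True
  then show ?thesis using assms by (intro bexI [of _ 1]) (auto simp: node_def)
next
  case False
  define j where "j = nat \<lceil>real J * x\<rceil>"
  have pos: "0 < real J * x" using assms False by simp
  have le: "real J * x \<le> real J" using assms by (simp add: mult_left_le)
  have j: "real J * x \<le> real j" "real j < real J * x + 1"
    unfolding j_def using pos by linarith+
  have "1 \<le> j" using j pos by linarith
  moreover have "j \<le> J" using j le by linarith
  moreover have "x \<in> {node J (j - 1)..node J j}"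
    using j \<open>1 \<le> j\<close> assms by (auto simp: node_def of_nat_diff field_simps)
  ultimately show ?thesis by auto
qed

lemma Vh_elementE:
  assumes "f \<in> Vh per J" "j \<in> {1..J}"
  obtains a b where "\<And>x. x \<in> {node J (j - 1)..node J j} \<Longrightarrow> f x = a * x + b"
  using assms unfolding Vh_def by blast

lemma Vh_affine:
  assumes "f \<in> Vh per J" "0 < J" "j \<in> {1..J}" "x \<in> {node J (j - 1)..node J j}"
  shows "f x = f (node J (j - 1))
    + real J * (x - node J (j - 1)) * (f (node J j) - f (node J (j - 1)))"
proof -
  obtain a b where ab: "\<And>x. x \<in> {node J (j - 1)..node J j} \<Longrightarrow> f x = a * x + b"
    by (rule Vh_elementE [OF assms(1,3)]) (rule that)
  have "1 \<le> j" using assms by simp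
  note less = node_less [OF \<open>0 < J\<close> this] and diff = node_diff [OF \<open>0 < J\<close> this]
  have "f (node J j) - f (node J (j - 1)) = a / real J"
    using ab [of "node J j"] ab [of "node J (j - 1)"] less diff
    by (simp flip: right_diff_distrib)
  then show ?thesis
    using ab [OF assms(4)] ab [of "node J (j - 1)"] less \<open>0 < J\<close>
    by (simp add: algebra_simps)
qed

lemma Vh_eqI:
  assumes "f \<in> Vh per J" "g \<in> Vh per J" "0 < J" "\<And>j. j \<le> J \<Longrightarrow> f (node J j) = g (node J j)"
  shows "f = g"
proof
  fix x
  show "f x = g x"
  proof (cases "x \<in> {0..1}")
    case False
    then show ?thesis using assms by (simp add: Vh_def)
  next
    case True
    then obtain j where j: "j \<in> {1..J}" "x \<in> {node J (j - 1)..node J j}"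
      using unit_interval_elements assms by blast
    have "f (node J (j - 1)) = g (node J (j - 1))" "f (node J j) = g (node J j)"
      using j by (auto intro!: assms(4))
    then show ?thesis
      using Vh_affine [OF assms(1,3) j] Vh_affine [OF assms(2,3) j] by simp
  qed
qed

text \<open>A combination of hat functions. The end nodes keep separate hats in the periodic case
  too; compatible data alone make the end values agree.\<close>

lemma Vh_interpolate:
  assumes "0 < J" and per: "per \<Longrightarrow> u 0 = u J"
  obtains f where "f \<in> Vh per J" "\<And>j. j \<le> J \<Longrightarrow> f (node J j) = u j"
proof -
  define hat :: "nat \<Rightarrow> real \<Rightarrow> real" where "hat i x = max 0 (1 - \<bar>real J * x - real i\<bar>)" for i x
  define f where "f x = (if x \<in> {0..1} then \<Sum>i\<le>J. u i * hat i x else 0)" for x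
  have hat_node: "hat i (node J j) = (if i = j then 1 else 0)" for i j
    using assms(1) by (auto simp: hat_def node_def)
  have val: "f (node J j) = u j" if "j \<le> J" for j
    using that node_in_unit [OF assms(1) that]
    by (simp add: f_def hat_node if_distrib [of "(*) _"] cong: if_cong)
  have affine: "\<exists>a b. \<forall>x\<in>{node J (j - 1)..node J j}. f x = a * x + b" if j: "j \<in> {1..J}" for j
  proof -
    \<comment> \<open>On element \<open>j\<close> only the hats of its two endpoints are nonzero:
      hat \<open>j\<close> is \<open>J * x + 1 - j\<close> and hat \<open>j - 1\<close> is
      \<open>j - J * x\<close>.\<close>
    define a where "a i = (if i = j then real J else if i = j - 1 then - real J else 0)" for i
    define b where "b i = (if i = j then 1 - real j else if i = j - 1 then real j else 0)" for i
    have "hat i x = a i * x + b i" if "x \<in> {node J (j - 1)..node J j}" for i x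
    proof -
      have x: "real j - 1 \<le> real J * x" "real J * x \<le> real j"
        using that j assms(1) by (auto simp: node_def field_simps of_nat_diff)
      consider "i = j" | "i = j - 1" "i \<noteq> j" | "i + 1 < j" | "i > j"
        using j by force
      then show ?thesis
      proof cases
        case 1
        then show ?thesis using x by (simp add: hat_def a_def b_def)
      next
        case 2
        then have "real i = real j - 1" using j by (simp add: of_nat_diff)
        then show ?thesis using x 2 by (simp add: hat_def a_def b_def)
      next
        case 3
        then have "real i + 1 \<le> real j - 1" "i \<noteq> j" "i \<noteq> j - 1" by linarith+
        then show ?thesis using x by (simp add: hat_def a_def b_def)
      next
        case 4
        then have "real i \<ge> real j + 1" "i \<noteq> j" "i \<noteq> j - 1" by linarith+
        then show ?thesis using x by (simp add: hat_def a_def b_def)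
      qed
    qed
    then have "f x = (\<Sum>i\<le>J. u i * a i) * x + (\<Sum>i\<le>J. u i * b i)"
      if "x \<in> {node J (j - 1)..node J j}" for x
      using that element_subset [OF assms(1), of j] j
      by (auto simp: f_def sum_distrib_right distrib_left sum.distrib mult.assoc)
    then show ?thesis by blast
  qed
  have cont: "continuous_on {0..1} f"
  proof -
    have "continuous_on {0..1} (\<lambda>x. \<Sum>i\<le>J. u i * hat i x)"
      unfolding hat_def by (intro continuous_intros)
    then show ?thesis by (rule continuous_on_eq) (simp add: f_def)
  qed
  have "f 0 = f 1" if per
    using val [of 0] val [of J] assms that by simp
  then have "f \<in> Vh per J"
    using affine cont by (auto simp: Vh_def f_def)
  with val that show thesis by blast
qed

lemma VVh_affine:
  assumes "f \<in> VVh per J" "0 < J" "j \<in> {1..J}" "x \<in> {node J (j - 1)..node J j}"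
  shows "f x = f (node J (j - 1))
    + (real J * (x - node J (j - 1))) *\<^sub>R (f (node J j) - f (node J (j - 1)))"
  using Vh_affine [OF _ assms(2-4), of "\<lambda>x. f x $ 1" per]
    Vh_affine [OF _ assms(2-4), of "\<lambda>x. f x $ 2" per] assms(1)
  by (simp add: VVh_def vec_eq_iff forall_2)

lemma VVh_eqI:
  assumes "f \<in> VVh per J" "g \<in> VVh per J" "0 < J" "\<And>j. j \<le> J \<Longrightarrow> f (node J j) = g (node J j)"
  shows "f = g"
proof -
  have "(\<lambda>x. f x $ 1) = (\<lambda>x. g x $ 1)" "(\<lambda>x. f x $ 2) = (\<lambda>x. g x $ 2)"
    using assms by (auto intro!: Vh_eqI [of _ per J] simp: VVh_def)
  then show ?thesis by (simp add: fun_eq_iff vec_eq_iff forall_2)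
qed

lemma VVh_interpolate:
  fixes u :: "nat \<Rightarrow> real^2"
  assumes "0 < J" and per: "per \<Longrightarrow> u 0 = u J"
  obtains f where "f \<in> VVh per J" "\<And>j. j \<le> J \<Longrightarrow> f (node J j) = u j"
proof -
  obtain f1 where f1: "f1 \<in> Vh per J" "\<And>j. j \<le> J \<Longrightarrow> f1 (node J j) = u j $ 1"
    using Vh_interpolate [OF assms(1), of per "\<lambda>j. u j $ 1"] per by auto
  obtain f2 where f2: "f2 \<in> Vh per J" "\<And>j. j \<le> J \<Longrightarrow> f2 (node J j) = u j $ 2"
    using Vh_interpolate [OF assms(1), of per "\<lambda>j. u j $ 2"] per by auto
  show thesis
  proof (rule that)
    show "(\<lambda>x. vector [f1 x, f2 x]) \<in> VVh per J"
      using f1 f2 by (simp add: VVh_def)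
    show "vector [f1 (node J j), f2 (node J j)] = u j" if "j \<le> J" for j
      using f1 f2 that by (simp add: vec_eq_iff forall_2)
  qed
qed

lemma VVh_continuous: "f \<in> VVh per J \<Longrightarrow> continuous_on {0..1} f"
proof -
  assume "f \<in> VVh per J"
  then have "continuous_on {0..1} (\<lambda>x. f x $ i)" for i
    using exhaust_2 [of i] by (auto simp: VVh_def Vh_def)
  then have "continuous_on {0..1} (\<lambda>x. \<chi> i. f x $ i)"
    by (rule continuous_on_vec_lambda)
  then show ?thesis by simp
qed

lemma Vh_continuous: "f \<in> Vh per J \<Longrightarrow> continuous_on {0..1} f"
  by (simp add: Vh_def)

lemma Vh_add: "f \<in> Vh per J \<Longrightarrow> g \<in> Vh per J \<Longrightarrow> (\<lambda>x. f x + g x) \<in> Vh per J"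
proof -
  assume f: "f \<in> Vh per J" and g: "g \<in> Vh per J"
  have "\<exists>a b. \<forall>x\<in>{node J (j - 1)..node J j}. f x + g x = a * x + b" if j: "j \<in> {1..J}" for j
  proof -
    obtain a b where "\<And>x. x \<in> {node J (j - 1)..node J j} \<Longrightarrow> f x = a * x + b"
      by (rule Vh_elementE [OF f j]) (rule that)
    moreover obtain a' b' where "\<And>x. x \<in> {node J (j - 1)..node J j} \<Longrightarrow> g x = a' * x + b'"
      by (rule Vh_elementE [OF g j]) (rule that)
    ultimately show ?thesis
      by (intro exI [of _ "a + a'"] exI [of _ "b + b'"]) (simp add: algebra_simps)
  qed
  moreover have "continuous_on {0..1} (\<lambda>x. f x + g x)"
    using f g by (intro continuous_on_add) (simp_all add: Vh_def)
  ultimately show ?thesis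
    using f g by (simp add: Vh_def)
qed

lemma VVh_add: "f \<in> VVh per J \<Longrightarrow> g \<in> VVh per J \<Longrightarrow> (\<lambda>x. f x + g x) \<in> VVh per J"
  using Vh_add [of "\<lambda>x. f x $ 1" per J "\<lambda>x. g x $ 1"] Vh_add [of "\<lambda>x. f x $ 2" per J "\<lambda>x. g x $ 2"]
  by (simp add: VVh_def)

section \<open>Derivatives, lumped sums and integrals element by element\<close>

definition slope :: "nat \<Rightarrow> (real \<Rightarrow> real^2) \<Rightarrow> nat \<Rightarrow> real^2" where
  "slope J f j = real J *\<^sub>R (f (node J j) - f (node J (j - 1)))"

text \<open>The slopes on both sides of a node may differ, so the derivative is identified in open
  elements, where the function is locally affine.\<close>

lemma drho_element:
  assumes "f \<in> VVh per J" "0 < J" "j \<in> {1..J}" "x \<in> {node J (j - 1)<..<node J j}"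
  shows "drho f x = slope J f j"
proof -
  let ?g = "\<lambda>x. f (node J (j - 1))
    + (real J * (x - node J (j - 1))) *\<^sub>R (f (node J j) - f (node J (j - 1)))"
  have "(?g has_vector_derivative slope J f j) (at x)"
    unfolding slope_def has_vector_derivative_def
    by (auto intro!: derivative_eq_intros simp: mult.commute)
  then have "(f has_vector_derivative slope J f j) (at x)"
    by (rule has_vector_derivative_transform_within_open [OF _ open_greaterThanLessThan assms(4)])
      (rule VVh_affine [OF assms(1-3), symmetric], simp)
  then show ?thesis unfolding drho_def by (rule vector_derivative_at)
qed

text \<open>One-sided limits see only the open elements, so \<open>F\<close> may be arbitrary at the
  nodes. Continuity of \<open>G j\<close> up to the endpoints evaluates the limits.\<close>

lemma lumped_piecewise:
  fixes F :: "real \<Rightarrow> 'a::real_normed_vector"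
  assumes "0 < J"
    and cont: "\<And>j. j \<in> {1..J} \<Longrightarrow> continuous_on {node J (j - 1)..node J j} (G j)"
    and eq: "\<And>j x. j \<in> {1..J} \<Longrightarrow> x \<in> {node J (j - 1)<..<node J j} \<Longrightarrow> F x = G j x"
  shows "lumped J F
    = (1 / (2 * real J)) *\<^sub>R (\<Sum>j=1..J. G j (node J j) + G j (node J (j - 1)))"
proof -
  have "Lim (at_left (node J j)) F = G j (node J j)"
    "Lim (at_right (node J (j - 1))) F = G j (node J (j - 1))" if j: "j \<in> {1..J}" for j
  proof -
    have less: "node J (j - 1) < node J j" using node_less assms j by simp
    have "(G j \<longlongrightarrow> G j (node J j)) (at_left (node J j))"
      using cont [OF j] less by (auto simp: continuous_on_Icc_at_leftD)
    moreover have "\<forall>\<^sub>F x in at_left (node J j). G j x = F x"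
      using eventually_at_left_real [OF less] by eventually_elim (simp add: eq [OF j])
    ultimately have "(F \<longlongrightarrow> G j (node J j)) (at_left (node J j))"
      by (rule Lim_transform_eventually)
    then show "Lim (at_left (node J j)) F = G j (node J j)"
      by (intro tendsto_Lim) auto
    have "(G j \<longlongrightarrow> G j (node J (j - 1))) (at_right (node J (j - 1)))"
      using cont [OF j] less by (auto simp: continuous_on_Icc_at_rightD)
    moreover have "\<forall>\<^sub>F x in at_right (node J (j - 1)). G j x = F x"
      using eventually_at_right_real [OF less] by eventually_elim (simp add: eq [OF j])
    ultimately have "(F \<longlongrightarrow> G j (node J (j - 1))) (at_right (node J (j - 1)))"
      by (rule Lim_transform_eventually)
    then show "Lim (at_right (node J (j - 1))) F = G j (node J (j - 1))"
      by (intro tendsto_Lim) auto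
  qed
  then show ?thesis by (simp add: lumped_def meshsize_def)
qed

text \<open>The trapezoidal rule is exact for affine integrands; exact integrals thus take the same
  form as lumped ones.\<close>

lemma L2_piecewise_affine:
  assumes "0 < J"
    and eq: "\<And>j x. j \<in> {1..J} \<Longrightarrow> x \<in> {node J (j - 1)<..<node J j} \<Longrightarrow> F x = G j x"
    and affine: "\<And>j x. j \<in> {1..J} \<Longrightarrow> x \<in> {node J (j - 1)..node J j} \<Longrightarrow> G j x
      = G j (node J (j - 1)) + (x - node J (j - 1)) * a j"
  shows "L2 F = (1 / (2 * real J)) * (\<Sum>j=1..J. G j (node J j) + G j (node J (j - 1)))"
proof -
  have elem: "(F has_integral (G j (node J j) + G j (node J (j - 1))) / (2 * real J))
      {node J (j - 1)..node J j}" if j: "j \<in> {1..J}" for j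
  proof -
    let ?s = "node J (j - 1)" and ?t = "node J j"
    have less: "?s < ?t" and diff: "?t = ?s + 1 / real J"
      using node_less [of J j] node_diff [of J j] assms(1) j by auto
    \<comment> \<open>The primitive is \<open>G j ?s * x + (x - ?s)^2 / 2 * a j\<close>.\<close>
    have "((\<lambda>x. G j ?s + (x - ?s) * a j) has_integral
        (G j ?s * ?t + (?t - ?s)\<^sup>2 / 2 * a j) - (G j ?s * ?s + (?s - ?s)\<^sup>2 / 2 * a j)) {?s..?t}"
      using less
      by (intro fundamental_theorem_of_calculus)
        (auto intro!: derivative_eq_intros simp flip: has_real_derivative_iff_has_vector_derivative)
    moreover have "(G j ?s * ?t + (?t - ?s)\<^sup>2 / 2 * a j) - (G j ?s * ?s + (?s - ?s)\<^sup>2 / 2 * a j)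
        = (G j ?t + G j ?s) / (2 * real J)"
    proof -
      have step: "?t - ?s = 1 / real J" using diff by simp
      then have Gt: "G j ?t = G j ?s + a j / real J"
        using affine [OF j, of ?t] less by simp
      have shift: "(G j ?s * ?t + (?t - ?s)\<^sup>2 / 2 * a j) - (G j ?s * ?s + (?s - ?s)\<^sup>2 / 2 * a j)
          = G j ?s * (1 / real J) + (1 / real J)\<^sup>2 / 2 * a j"
        unfolding step [symmetric] by (simp add: right_diff_distrib)
      show ?thesis
        unfolding shift Gt using assms(1) by (simp add: field_simps power2_eq_square)
    qed
    ultimately have "((\<lambda>x. G j ?s + (x - ?s) * a j) has_integral
        (G j ?t + G j ?s) / (2 * real J)) {?s..?t}" by simp
    then show ?thesis
      \<comment> \<open>\<open>F\<close> is unconstrained at the two endpoints, a finite set that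
        does not affect the integral.\<close>
      by (rule has_integral_spike_finite [of "{?s, ?t}", rotated 2])
        (use eq [OF j] affine [OF j, symmetric] in auto)
  qed
  have "(F has_integral (\<Sum>j=1..n. (G j (node J j) + G j (node J (j - 1))) / (2 * real J)))
      {0..node J n}" if "n \<le> J" for n
    using that
  proof (induction n)
    case 0
    then show ?case by (simp add: has_integral_refl)
  next
    case (Suc n)
    have "(F has_integral (\<Sum>j=1..n. (G j (node J j) + G j (node J (j - 1))) / (2 * real J))
        + (G (Suc n) (node J (Suc n)) + G (Suc n) (node J n)) / (2 * real J)) {0..node J (Suc n)}"
    proof (rule has_integral_combine)
      show "0 \<le> node J n" by (simp add: node_def)
      show "node J n \<le> node J (Suc n)" by (simp add: node_def divide_right_mono)
    qed (use Suc elem [of "Suc n"] in simp_all)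
    then show ?case by simp
  qed
  from this [of J] have "(F has_integral (\<Sum>j=1..J. (G j (node J j) + G j (node J (j - 1))) / (2 * real J))) {0..1}"
    using assms(1) by simp
  then show ?thesis
    unfolding L2_def by (simp add: integral_unique sum_divide_distrib)
qed

text \<open>The first index of the summand is the element, the second one the endpoint.\<close>

definition trapezoid :: "nat \<Rightarrow> (nat \<Rightarrow> nat \<Rightarrow> 'a::real_vector) \<Rightarrow> 'a" where
  "trapezoid J g = (1 / (2 * real J)) *\<^sub>R (\<Sum>j=1..J. g j j + g j (j - 1))"

lemma trapezoid_cong:
  assumes "\<And>j i. j \<in> {1..J} \<Longrightarrow> i \<le> J \<Longrightarrow> g j i = g' j i"
  shows "trapezoid J g = trapezoid J g'"
  unfolding trapezoid_def using assms by (intro arg_cong2 [of _ _ _ _ scaleR] sum.cong) auto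

lemma trapezoid_0 [simp]: "trapezoid J (\<lambda>j i. 0) = 0"
  by (simp add: trapezoid_def)

lemma trapezoid_add: "trapezoid J (\<lambda>j i. g j i + g' j i) = trapezoid J g + trapezoid J g'"
  by (simp add: trapezoid_def sum.distrib algebra_simps)

lemma trapezoid_diff: "trapezoid J (\<lambda>j i. g j i - g' j i) = trapezoid J g - trapezoid J g'"
  by (simp add: trapezoid_def sum.distrib sum_subtractf algebra_simps)

lemma trapezoid_nonneg: "(\<And>j i. 0 \<le> g j i) \<Longrightarrow> 0 \<le> trapezoid J g" for g :: "nat \<Rightarrow> nat \<Rightarrow> real"
  by (simp add: trapezoid_def sum_nonneg)

lemma trapezoid_eq_0D:
  fixes g :: "nat \<Rightarrow> nat \<Rightarrow> real"
  assumes "0 < J" "trapezoid J g = 0" "\<And>j i. 0 \<le> g j i" "j \<in> {1..J}"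
  shows "g j j = 0" "g j (j - 1) = 0"
proof -
  have "(\<Sum>j=1..J. g j j + g j (j - 1)) = 0" using assms(1,2) by (simp add: trapezoid_def)
  then have "g j j + g j (j - 1) = 0"
    using assms(3,4) by (subst (asm) sum_nonneg_eq_0_iff) auto
  then show "g j j = 0" "g j (j - 1) = 0"
    using assms(3) [of j j] assms(3) [of j "j - 1"] by linarith+
qed

section \<open>Closure properties of linear functionals\<close>

lemma linear_functional_add:
  "linear_functional f \<Longrightarrow> linear_functional g \<Longrightarrow> linear_functional (\<lambda>x. f x + g x)"
  by (simp add: linear_functional_def algebra_simps)

lemma linear_functional_diff:
  "linear_functional f \<Longrightarrow> linear_functional g \<Longrightarrow> linear_functional (\<lambda>x. f x - g x)"
  by (simp add: linear_functional_def algebra_simps)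

lemma linear_functional_mult_left: "linear_functional f \<Longrightarrow> linear_functional (\<lambda>x. c * f x)"
  by (simp add: linear_functional_def algebra_simps)

lemma linear_functional_mult_right: "linear_functional f \<Longrightarrow> linear_functional (\<lambda>x. f x * c)"
  by (simp add: linear_functional_def algebra_simps)

lemma linear_functional_divide: "linear_functional f \<Longrightarrow> linear_functional (\<lambda>x. f x / c)"
  by (simp add: linear_functional_def add_divide_distrib)

lemma linear_functional_sum:
  "(\<And>a. linear_functional (f a)) \<Longrightarrow> linear_functional (\<lambda>x. \<Sum>a\<in>S. f a x)"
  by (simp add: linear_functional_def sum.distrib sum_distrib_left)

lemma linear_functional_trapezoid:
  "(\<And>j i. linear_functional (f j i)) \<Longrightarrow> linear_functional (\<lambda>x. trapezoid J (\<lambda>j i. f j i x))"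
  unfolding trapezoid_def real_scaleR_def
  by (intro linear_functional_mult_left linear_functional_sum linear_functional_add)

section \<open>Nodal coefficients\<close>

text \<open>A pair of discrete functions in \<^term>\<open>VVh per J \<times> Vh per J\<close> is encoded by coefficients
  \<^term>\<open>x (j, k)\<close>, where \<^term>\<open>k = 0\<close> stands for the scalar function and \<^term>\<open>k = 1\<close>,
  \<^term>\<open>k = 2\<close> for the components of the vector function. In the periodic case the nodes
  \<^term>\<open>0\<close> and \<^term>\<open>J\<close> share the coefficient of \<^term>\<open>J\<close>.\<close>

definition ncoef :: "bool \<Rightarrow> nat \<Rightarrow> (nat \<times> nat \<Rightarrow> real) \<Rightarrow> nat \<Rightarrow> nat \<Rightarrow> real" where
  "ncoef per J x k j = x (if per \<and> j = 0 then J else j, k)"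

definition vcoef :: "bool \<Rightarrow> nat \<Rightarrow> (nat \<times> nat \<Rightarrow> real) \<Rightarrow> nat \<Rightarrow> real^2" where
  "vcoef per J x j = vector [ncoef per J x 1 j, ncoef per J x 2 j]"

text \<open>Coefficients at indices that are never read stay free here; \<open>x\<close> becomes
  unique only together with a support condition.\<close>

definition represents ::
  "bool \<Rightarrow> nat \<Rightarrow> (nat \<times> nat \<Rightarrow> real) \<Rightarrow> (real \<Rightarrow> real^2) \<Rightarrow> (real \<Rightarrow> real) \<Rightarrow> bool" where
  "represents per J x f \<kappa> \<longleftrightarrow>
    (\<forall>j\<le>J. f (node J j) = vcoef per J x j \<and> \<kappa> (node J j) = ncoef per J x 0 j)"

definition nodal :: "nat \<Rightarrow> (real \<Rightarrow> real^2) \<Rightarrow> (real \<Rightarrow> real) \<Rightarrow> nat \<Rightarrow> nat \<Rightarrow> real" where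
  "nodal J f \<kappa> j k =
    (if k = 0 then \<kappa> (node J j) else if k = 1 then f (node J j) $ 1 else f (node J j) $ 2)"

text \<open>\<open>Z\<close> lists the coefficients that boundary conditions or the choice of
  components force to vanish.\<close>

definition dofs :: "bool \<Rightarrow> nat \<Rightarrow> (nat \<times> nat) set \<Rightarrow> (nat \<times> nat) set" where
  "dofs per J Z = {(j, k). j \<le> J \<and> (per \<longrightarrow> 0 < j) \<and> k \<le> 2} - Z"

lemma finite_dofs: "finite (dofs per J Z)"
  by (rule finite_subset [of _ "{..J} \<times> {..2}"]) (auto simp: dofs_def)

lemma vcoef_add_scale:
  "vcoef per J (\<lambda>i. x i + c * y i) j = vcoef per J x j + c *\<^sub>R vcoef per J y j"
  by (simp add: vcoef_def ncoef_def vec_eq_iff forall_2)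

lemma linear_functional_ncoef: "linear_functional (\<lambda>x. ncoef per J x k j)"
  by (simp add: linear_functional_def ncoef_def)

lemma linear_functional_vcoef:
  "linear_functional (\<lambda>x. vcoef per J x j \<bullet> v)" "linear_functional (\<lambda>x. v \<bullet> vcoef per J x j)"
  "linear_functional (\<lambda>x. (vcoef per J x j - vcoef per J x i) \<bullet> v)"
  "linear_functional (\<lambda>x. v \<bullet> (vcoef per J x j - vcoef per J x i))"
  by (simp_all add: linear_functional_def vcoef_add_scale algebra_simps inner_diff_left
      inner_diff_right inner_add_left inner_add_right)

lemmas linear_functional_intros = linear_functional_ncoef linear_functional_vcoef
  linear_functional_add linear_functional_diff linear_functional_mult_left
  linear_functional_mult_right linear_functional_divide linear_functional_sum
  linear_functional_trapezoid

lemma represents_exists: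
  assumes "0 < J"
  obtains f \<kappa> where "f \<in> VVh per J" "\<kappa> \<in> Vh per J" "represents per J x f \<kappa>"
proof -
  obtain f where "f \<in> VVh per J" "\<And>j. j \<le> J \<Longrightarrow> f (node J j) = vcoef per J x j"
    by (rule VVh_interpolate [OF assms, of per "vcoef per J x"])
      (auto simp: vcoef_def ncoef_def)
  moreover obtain \<kappa> where "\<kappa> \<in> Vh per J" "\<And>j. j \<le> J \<Longrightarrow> \<kappa> (node J j) = ncoef per J x 0 j"
    by (rule Vh_interpolate [OF assms, of per "ncoef per J x 0"])
      (auto simp: ncoef_def)
  ultimately show thesis using that by (auto simp: represents_def)
qed

lemma coefficients_exist:
  assumes J: "0 < J" and f: "f \<in> VVh per J" and \<kappa>: "\<kappa> \<in> Vh per J"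
    and Z: "\<And>j k. (j, k) \<in> Z \<Longrightarrow> j \<le> J \<Longrightarrow> nodal J f \<kappa> j k = 0"
  obtains x where "x \<in> supported_on (dofs per J Z)" "represents per J x f \<kappa>"
proof -
  \<comment> \<open>Truncation loses nothing: a dropped coefficient is zero by the assumption on
    \<open>Z\<close>, or it belongs to the periodic copy at node 0, which is read at
    \<open>J\<close>.\<close>
  define x where "x = (\<lambda>(j, k). if (j, k) \<in> dofs per J Z then nodal J f \<kappa> j k else 0)"
  have "x \<in> supported_on (dofs per J Z)"
    by (auto simp: supported_on_def x_def)
  moreover have "ncoef per J x k j = nodal J f \<kappa> j k" if "j \<le> J" "k \<le> 2" for j k
  proof -
    let ?j = "if per \<and> j = 0 then J else j"
    have "x (?j, k) = nodal J f \<kappa> ?j k"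
      using that J Z [of ?j k] by (auto simp: x_def dofs_def)
    also have "\<dots> = nodal J f \<kappa> j k"
      using f \<kappa> J by (auto simp: nodal_def VVh_def Vh_def)
    finally show ?thesis by (simp add: ncoef_def)
  qed
  then have "represents per J x f \<kappa>"
    by (simp add: represents_def vcoef_def vec_eq_iff forall_2) (simp add: nodal_def)
  ultimately show thesis using that by blast
qed

lemma supported_zeroI:
  assumes "0 < J" "x \<in> supported_on (dofs per J Z)"
    and "\<And>j. j \<le> J \<Longrightarrow> ncoef per J x 0 j = 0" "\<And>j. j \<le> J \<Longrightarrow> vcoef per J x j = 0"
  shows "x = (\<lambda>_. 0)"
proof
  fix i
  show "x i = 0"
  proof (cases "i \<in> dofs per J Z")
    case False
    then show ?thesis using assms(2) unfolding supported_on_def by blast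
  next
    case True
    then obtain j k where i: "i = (j, k)" "j \<le> J" "per \<longrightarrow> 0 < j" "k \<le> 2"
      by (auto simp: dofs_def)
    then have x: "x i = ncoef per J x k j" by (auto simp: ncoef_def)
    consider "k = 0" | "k = 1" | "k = 2" using \<open>k \<le> 2\<close> by linarith
    then show ?thesis
      using assms(3,4) [OF \<open>j \<le> J\<close>] unfolding x
      by cases (auto simp: vcoef_def vec_eq_iff forall_2)
  qed
qed

section \<open>The discrete curve\<close>

locale fe_curve =
  fixes per :: bool and J :: nat and X :: "real \<Rightarrow> real^2"
  assumes J_pos: "0 < J" and X_fe: "X \<in> VVh per J"
    and regular: "\<And>j. j \<in> {1..J} \<Longrightarrow> slope J X j \<noteq> 0"
begin

definition len :: "nat \<Rightarrow> real" where "len j = norm (slope J X j)"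

text \<open>The product of \<open>nu X\<close> with its weight \<open>norm (drho X x)\<close> on
  element \<open>j\<close>: the weight cancels the normalisation.\<close>

definition nrm :: "nat \<Rightarrow> real^2" where "nrm j = - perp (slope J X j)"

lemma len_nonneg: "0 \<le> len j"
  by (simp add: len_def)

lemma len_pos: "j \<in> {1..J} \<Longrightarrow> 0 < len j"
  using regular by (simp add: len_def)

lemma len_nonzero: "j \<in> {1..J} \<Longrightarrow> len j \<noteq> 0"
  using len_pos by force

lemma drho_curve:
  assumes "j \<in> {1..J}" "x \<in> {node J (j - 1)<..<node J j}"
  shows "norm (drho X x) = len j" "nu X x = (1 / len j) *\<^sub>R nrm j"
  using drho_element [OF X_fe J_pos assms] by (simp_all add: nu_def len_def nrm_def)

lemma continuous_on_element:
  assumes "continuous_on {0..1} f" "j \<in> {1..J}"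
  shows "continuous_on {node J (j - 1)..node J j} f"
  using assms element_subset [OF J_pos, of j] by (auto intro: continuous_on_subset)

lemmas fe_continuous = continuous_on_element [OF VVh_continuous] continuous_on_element [OF Vh_continuous]

lemma lumped_trapezoid:
  assumes "\<And>j. j \<in> {1..J} \<Longrightarrow> continuous_on {node J (j - 1)..node J j} (G j)"
    and "\<And>j x. j \<in> {1..J} \<Longrightarrow> x \<in> {node J (j - 1)<..<node J j} \<Longrightarrow> F x = G j x"
  shows "lumped J F = trapezoid J (\<lambda>j i. G j (node J i))"
  unfolding trapezoid_def by (rule lumped_piecewise [OF J_pos assms])

lemma lumped_velocity:
  assumes "f \<in> VVh per J" "c \<in> Vh per J"
  shows "lumped J (\<lambda>x. ((1 / dt) *\<^sub>R ((X x + f x) - X x)) \<bullet> ((c x * norm (drho X x)) *\<^sub>R nu X x))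
    = trapezoid J (\<lambda>j i. c (node J i) * ((f (node J i) \<bullet> nrm j) / dt))"
proof (rule lumped_trapezoid [of "\<lambda>j x. c x * ((f x \<bullet> nrm j) / dt)"])
  show "continuous_on {node J (j - 1)..node J j} (\<lambda>x. c x * ((f x \<bullet> nrm j) / dt))"
    if "j \<in> {1..J}" for j
    using that assms unfolding divide_inverse by (intro continuous_intros fe_continuous)
qed (simp add: drho_curve len_nonzero)

lemma lumped_curvature:
  assumes "\<kappa> \<in> Vh per J" "K \<in> Vh per J" "c \<in> Vh per J"
  shows "lumped J (\<lambda>x. (\<kappa> x - K x) * (c x * norm (drho X x)))
    = trapezoid J (\<lambda>j i. c (node J i) * (len j * (\<kappa> (node J i) - K (node J i))))"
proof (rule lumped_trapezoid [of "\<lambda>j x. c x * (len j * (\<kappa> x - K x))"])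
  show "continuous_on {node J (j - 1)..node J j} (\<lambda>x. c x * (len j * (\<kappa> x - K x)))"
    if "j \<in> {1..J}" for j
    using that assms by (intro continuous_intros fe_continuous)
qed (auto simp: drho_curve)

lemma lumped_curvature_vector:
  assumes "\<kappa> \<in> Vh per J" "\<eta> \<in> VVh per J"
  shows "lumped J (\<lambda>x. (\<kappa> x *\<^sub>R nu X x) \<bullet> (norm (drho X x) *\<^sub>R \<eta> x))
    = trapezoid J (\<lambda>j i. \<kappa> (node J i) * (nrm j \<bullet> \<eta> (node J i)))"
proof (rule lumped_trapezoid [of "\<lambda>j x. \<kappa> x * (nrm j \<bullet> \<eta> x)"])
  show "continuous_on {node J (j - 1)..node J j} (\<lambda>x. \<kappa> x * (nrm j \<bullet> \<eta> x))"
    if "j \<in> {1..J}" for j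
    using that assms by (intro continuous_intros fe_continuous)
qed (simp add: drho_curve len_nonzero)

lemma lumped_normal:
  assumes "c \<in> Vh per J"
  shows "lumped J (\<lambda>x. (c x * norm (drho X x)) *\<^sub>R nu X x)
    = trapezoid J (\<lambda>j i. c (node J i) *\<^sub>R nrm j)"
proof (rule lumped_trapezoid [of "\<lambda>j x. c x *\<^sub>R nrm j"])
  show "continuous_on {node J (j - 1)..node J j} (\<lambda>x. c x *\<^sub>R nrm j)"
    if "j \<in> {1..J}" for j
    using that assms by (intro continuous_intros fe_continuous)
qed (simp add: drho_curve len_nonzero)

lemma lumped_mass:
  assumes "w \<in> VVh per J" "\<phi> \<in> VVh per J"
  shows "lumped J (\<lambda>x. w x \<bullet> (norm (drho X x) *\<^sub>R \<phi> x))
    = trapezoid J (\<lambda>j i. len j * (w (node J i) \<bullet> \<phi> (node J i)))"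
proof (rule lumped_trapezoid [of "\<lambda>j x. len j * (w x \<bullet> \<phi> x)"])
  show "continuous_on {node J (j - 1)..node J j} (\<lambda>x. len j * (w x \<bullet> \<phi> x))"
    if "j \<in> {1..J}" for j
    using that assms by (intro continuous_intros fe_continuous)
qed (auto simp: drho_curve)

text \<open>The weighted normal is constant on each element, so the integrand is affine there. Both
  sides of the equation defining \<open>omega\<close> thereby become trapezoidal sums.\<close>

lemma L2_normal:
  assumes "\<phi> \<in> VVh per J"
  shows "L2 (\<lambda>x. nu X x \<bullet> (norm (drho X x) *\<^sub>R \<phi> x))
    = trapezoid J (\<lambda>j i. nrm j \<bullet> \<phi> (node J i))"
  unfolding trapezoid_def real_scaleR_def
proof (rule L2_piecewise_affine [OF J_pos, where a = "\<lambda>j. nrm j \<bullet> slope J \<phi> j"])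
  show "nu X x \<bullet> (norm (drho X x) *\<^sub>R \<phi> x) = nrm j \<bullet> \<phi> x"
    if "j \<in> {1..J}" "x \<in> {node J (j - 1)<..<node J j}" for j x
    using that len_pos [of j] by (simp add: drho_curve)
  show "nrm j \<bullet> \<phi> x = nrm j \<bullet> \<phi> (node J (j - 1)) + (x - node J (j - 1)) * (nrm j \<bullet> slope J \<phi> j)"
    if "j \<in> {1..J}" "x \<in> {node J (j - 1)..node J j}" for j x
    using VVh_affine [OF assms J_pos that]
    by (simp add: slope_def inner_add_right)
qed

text \<open>The integrand is constant on each element. Each of the two slopes contributes a factor
  \<open>J\<close>, and the element length takes one of them away.\<close>

lemma L2_stiffness:
  assumes "Y \<in> VVh per J" "\<eta> \<in> VVh per J"
  shows "L2 (\<lambda>x. drho Y x \<bullet> ((1 / norm (drho X x)) *\<^sub>R drho \<eta> x))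
    = real J * (\<Sum>j=1..J. ((Y (node J j) - Y (node J (j - 1)))
        \<bullet> (\<eta> (node J j) - \<eta> (node J (j - 1)))) / len j)"
proof -
  have "L2 (\<lambda>x. drho Y x \<bullet> ((1 / norm (drho X x)) *\<^sub>R drho \<eta> x)) = (1 / (2 * real J)) *
      (\<Sum>j=1..J. (slope J Y j \<bullet> slope J \<eta> j) / len j + (slope J Y j \<bullet> slope J \<eta> j) / len j)"
    by (rule L2_piecewise_affine [OF J_pos, where a = "\<lambda>_. 0"])
      (use drho_element [OF assms(1) J_pos] drho_element [OF assms(2) J_pos] in
        \<open>auto simp: drho_curve\<close>)
  also have "\<dots> = (\<Sum>j=1..J. (slope J Y j \<bullet> slope J \<eta> j) / len j / real J)"
    by (simp add: sum_distrib_left mult.commute)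
  also have "\<dots> = (\<Sum>j=1..J. real J * (((Y (node J j) - Y (node J (j - 1)))
        \<bullet> (\<eta> (node J j) - \<eta> (node J (j - 1)))) / len j))"
    using J_pos by (simp add: slope_def)
  finally show ?thesis by (simp add: sum_distrib_left)
qed

text \<open>The lumped mass form is positive definite because all \<open>len j\<close> are positive,
  so the definite description is meaningful. The result is needed for the periodicity of
  \<open>omega\<close>, on which the interpolation behind \<open>Kop\<close> relies.\<close>

lemma omega_fe: "omega per J X \<in> VVh per J"
proof -
  \<comment> \<open>Without the indices \<open>k = 0\<close> only the vector component is left; its
    scalar partner is the zero function.\<close>
  let ?Z = "{(j, k). k = (0::nat)}"
  let ?S = "supported_on (dofs per J ?Z)"
  define B where "B x y = trapezoid J (\<lambda>j i. len j * (vcoef per J x i \<bullet> vcoef per J y i))" for x y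
  define l where "l y = trapezoid J (\<lambda>j i. nrm j \<bullet> vcoef per J y i)" for y
  have ex1: "\<exists>!x. x \<in> ?S \<and> (\<forall>y\<in>?S. B x y = l y)"
  proof (rule nondegenerate_bilinear_unique_solution [OF finite_dofs])
    show "linear_functional (\<lambda>x. B x y)" "linear_functional (B x)" "linear_functional l" for x y
      unfolding B_def l_def by (intro linear_functional_intros)+
    fix x assume x: "x \<in> ?S" "\<forall>y\<in>?S. B x y = 0"
    have "ncoef per J x 0 j = 0" for j
      using x(1) by (simp add: supported_on_def ncoef_def dofs_def)
    moreover have "vcoef per J x i = 0" if "i \<le> J" for i
    proof -
      have "B x x = 0" using x by blast
      note 0 = trapezoid_eq_0D [OF J_pos this [unfolded B_def]]
      show ?thesis
      \<comment> \<open>Node \<open>i\<close> is the right end of element \<open>i\<close>; the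
        index 0 occurs only as the left end of element 1.\<close>
      proof (cases "i = 0")
        case True
        then show ?thesis
          using 0(2) [of 1] len_pos [of 1] J_pos by (simp add: len_nonneg)
      next
        case False
        then show ?thesis
          using 0(1) [of i] len_pos [of i] that by (simp add: len_nonneg)
      qed
    qed
    ultimately show "x = (\<lambda>_. 0)" using supported_zeroI [OF J_pos x(1)] by blast
  qed
  have zero_fe: "(\<lambda>_. 0) \<in> Vh per J" by (auto simp: Vh_def intro: exI [of _ 0])
  have coef: "\<exists>x. x \<in> ?S \<and> represents per J x w (\<lambda>_. 0)" if "w \<in> VVh per J" for w
    using coefficients_exist [OF J_pos that zero_fe, of ?Z] by (auto simp: nodal_def)
  have weak: "(\<forall>\<phi>\<in>VVh per J. lumped J (\<lambda>x. w x \<bullet> (norm (drho X x) *\<^sub>R \<phi> x))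
      = L2 (\<lambda>x. nu X x \<bullet> (norm (drho X x) *\<^sub>R \<phi> x))) \<longleftrightarrow> (\<forall>y\<in>?S. B x y = l y)"
    if w: "w \<in> VVh per J" and x: "represents per J x w c" for w x c
  proof -
    have eq: "lumped J (\<lambda>x. w x \<bullet> (norm (drho X x) *\<^sub>R \<phi> x)) = B x y"
      "L2 (\<lambda>x. nu X x \<bullet> (norm (drho X x) *\<^sub>R \<phi> x)) = l y"
      if "\<phi> \<in> VVh per J" "represents per J y \<phi> c'" for \<phi> y c'
      unfolding lumped_mass [OF w that(1)] L2_normal [OF that(1)] B_def l_def
      using x that(2) by (auto simp: represents_def intro!: trapezoid_cong)
    show ?thesis
    proof (intro iffI ballI)
      fix y assume "\<forall>\<phi>\<in>VVh per J. lumped J (\<lambda>x. w x \<bullet> (norm (drho X x) *\<^sub>R \<phi> x))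
        = L2 (\<lambda>x. nu X x \<bullet> (norm (drho X x) *\<^sub>R \<phi> x))"
      moreover obtain \<phi> c' where "\<phi> \<in> VVh per J" "represents per J y \<phi> c'"
        using represents_exists [OF J_pos] by blast
      ultimately show "B x y = l y" using eq [of \<phi> y c'] by simp
    next
      fix \<phi> assume sol: "\<forall>y\<in>?S. B x y = l y" and \<phi>: "\<phi> \<in> VVh per J"
      obtain y where "y \<in> ?S" "represents per J y \<phi> (\<lambda>_. 0)"
        using coef [OF \<phi>] by blast
      then show "lumped J (\<lambda>x. w x \<bullet> (norm (drho X x) *\<^sub>R \<phi> x))
        = L2 (\<lambda>x. nu X x \<bullet> (norm (drho X x) *\<^sub>R \<phi> x))"
        using sol eq [OF \<phi>] by simp
    qed
  qed
  from ex1 obtain x where x: "x \<in> ?S" "\<forall>y\<in>?S. B x y = l y" by blast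
  obtain w c where w: "w \<in> VVh per J" "represents per J x w c"
    using represents_exists [OF J_pos] by blast
  show ?thesis
    unfolding omega_def
  proof (rule theI2 [of _ w])
    show "w \<in> VVh per J \<and> (\<forall>\<phi>\<in>VVh per J. lumped J (\<lambda>x. w x \<bullet> (norm (drho X x) *\<^sub>R \<phi> x))
        = L2 (\<lambda>x. nu X x \<bullet> (norm (drho X x) *\<^sub>R \<phi> x)))"
      using w x weak by blast
    fix v assume v: "v \<in> VVh per J \<and> (\<forall>\<phi>\<in>VVh per J. lumped J (\<lambda>x. v x \<bullet> (norm (drho X x) *\<^sub>R \<phi> x))
        = L2 (\<lambda>x. nu X x \<bullet> (norm (drho X x) *\<^sub>R \<phi> x)))"
    then obtain z where z: "z \<in> ?S" "represents per J z v (\<lambda>_. 0)" using coef by blast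
    then have "\<forall>y\<in>?S. B z y = l y" using weak v by blast
    then have "z = x" using ex1 x z by blast
    then show "v = w"
      using v w z by (auto intro!: VVh_eqI [OF _ _ J_pos] simp: represents_def)
  qed simp
qed

text \<open>In the periodic case interpolation needs equal data at both end nodes: \<open>P0\<close>
  is empty then, and \<open>omega\<close> and \<open>X\<close> are periodic.\<close>

lemma Kop_fe:
  assumes \<kappa>: "\<kappa> \<in> Vh per J" and P0: "per \<longrightarrow> P0 = {}"
  shows "Kop per J P0 X \<kappa> \<in> Vh per J"
    and "j \<le> J \<Longrightarrow> Kop per J P0 X \<kappa> (node J j) = (if node J j \<in> P0 then - \<kappa> (node J j)
                      else (omega per J X (node J j) \<bullet> e1) / (X (node J j) \<bullet> e1))"
proof -
  let ?u = "\<lambda>j. if node J j \<in> P0 then - \<kappa> (node J j)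
                      else (omega per J X (node J j) \<bullet> e1) / (X (node J j) \<bullet> e1)"
  have "?u 0 = ?u J" if per
    using that P0 omega_fe X_fe J_pos by (simp add: e1_def inner_axis VVh_def Vh_def)
  then obtain f where f: "f \<in> Vh per J" "\<And>j. j \<le> J \<Longrightarrow> f (node J j) = ?u j"
    using Vh_interpolate [OF J_pos, of per ?u] by blast
  then have "Kop per J P0 X \<kappa> = f"
    unfolding Kop_def by (intro the_equality) (auto intro!: Vh_eqI [OF _ _ J_pos])
  with f show "Kop per J P0 X \<kappa> \<in> Vh per J" "j \<le> J \<Longrightarrow> Kop per J P0 X \<kappa> (node J j) = ?u j"
    by simp_all
qed

end

section \<open>The linear system\<close>

locale fe_scheme = fe_curve +
  fixes D P0 P1 P2 :: "real set" and rhohat :: "real \<Rightarrow> real" and dt :: real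
  assumes part: "D \<union> P0 \<union> P1 \<union> P2 = bdryI per"
    and spanning: "assmB per J X"
    and dt_pos: "0 < dt"
begin

abbreviation nc where "nc \<equiv> ncoef per J"
abbreviation vc where "vc \<equiv> vcoef per J"

definition constrained :: "(nat \<times> nat) set" where
  "constrained = {(j, k). k = 1 \<and> node J j \<in> D \<union> P0 \<union> P1 \<or> k = 2 \<and> node J j \<in> D \<union> P2}"

abbreviation W where "W \<equiv> supported_on (dofs per J constrained)"

text \<open>With \<open>src\<close> below, \<kappa> - K equals \<open>lam i\<close> times \<kappa>
  minus \<open>src i\<close> at node \<open>i\<close>. This separates the part linear in \<kappa>
  from the data.\<close>

definition lam :: "nat \<Rightarrow> real" where
  "lam i = (if node J i \<in> P0 then 2 else 1)"

definition src :: "nat \<Rightarrow> real" where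
  "src i = (if node J i \<in> P0 then 0 else (omega per J X (node J i) \<bullet> e1) / (X (node J i) \<bullet> e1))"

definition stiff :: "(nat \<Rightarrow> real^2) \<Rightarrow> (nat \<Rightarrow> real^2) \<Rightarrow> real" where
  "stiff Y \<eta> = real J * (\<Sum>j=1..J. ((Y j - Y (j - 1)) \<bullet> (\<eta> j - \<eta> (j - 1))) / len j)"

definition bnode :: "real \<Rightarrow> nat" where
  "bnode p = (if p = 0 then 0 else J)"

text \<open>The left-hand sides of both equations are added. Nothing is lost, since the scalar and
  vector test coefficients vary independently.\<close>

definition bform :: "(nat \<times> nat \<Rightarrow> real) \<Rightarrow> (nat \<times> nat \<Rightarrow> real) \<Rightarrow> real" where
  "bform x y =
    trapezoid J (\<lambda>j i. nc y 0 i * ((vc x i \<bullet> nrm j) / dt - len j * (lam i * nc x 0 i)))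
    + (trapezoid J (\<lambda>j i. nc x 0 i * (nrm j \<bullet> vc y i)) + stiff (vc x) (vc y))"

definition lform :: "(nat \<times> nat \<Rightarrow> real) \<Rightarrow> real" where
  "lform y = trapezoid J (\<lambda>j i. nc y 0 i * (- (len j * src i)))
    + (- 1) * (stiff (\<lambda>j. X (node J j)) (vc y)
        + ((\<Sum>p\<in>P1. rhohat p * (vc y (bnode p) \<bullet> e2)) + (\<Sum>p\<in>P2. rhohat p * (vc y (bnode p) \<bullet> e1))))"

lemma bdry_subset: "D \<union> P0 \<union> P1 \<union> P2 \<subseteq> {0, 1}" "per \<Longrightarrow> D \<union> P0 \<union> P1 \<union> P2 = {}"
  unfolding part bdryI_def by auto

lemma bnode:
  assumes "p \<in> D \<union> P0 \<union> P1 \<union> P2"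
  shows "\<not> per" "node J (bnode p) = p" "bnode p \<le> J"
  using assms bdry_subset J_pos by (auto simp: bnode_def)

lemma represents_bdry:
  assumes "represents per J x f \<kappa>" "p \<in> D \<union> P0 \<union> P1 \<union> P2"
  shows "f p = vc x (bnode p)"
  using assms(1) bnode [OF assms(2)] unfolding represents_def by (metis (no_types))

lemma bform_nondegenerate:
  assumes x: "x \<in> W" and null: "\<forall>y\<in>W. bform x y = 0"
  shows "x = (\<lambda>_. 0)"
proof -
  txt \<open>Testing with \<open>\<chi> = - dt \<kappa>\<close> and \<open>\<eta> = \<delta>X\<close> cancels the coupling terms.\<close>
  define y where "y = (\<lambda>(j, k). if k = (0::nat) then - dt * x (j, k) else x (j, k))"
  have "y \<in> W" using x by (auto simp: supported_on_def y_def)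
  then have xy: "bform x y = 0" using null by blast
  have y: "nc y 0 i = - dt * nc x 0 i" "vc y i = vc x i" for i
    by (simp_all add: y_def ncoef_def vcoef_def)
  have vy: "vc y = vc x" by (rule ext) (rule y(2))
  let ?e = "\<lambda>j i. dt * (len j * (lam i * (nc x 0 i)\<^sup>2))"
  have diag: "trapezoid J (\<lambda>j i. nc y 0 i * ((vc x i \<bullet> nrm j) / dt - len j * (lam i * nc x 0 i)))
      + trapezoid J (\<lambda>j i. nc x 0 i * (nrm j \<bullet> vc y i)) = trapezoid J ?e"
    unfolding trapezoid_add [symmetric] using dt_pos
    by (intro trapezoid_cong) (simp add: y field_simps power2_eq_square inner_commute)
  from xy have energy: "trapezoid J ?e + stiff (vc x) (vc x) = 0"
    unfolding bform_def diag [symmetric] vy by linarith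
  have e_nonneg: "0 \<le> ?e j i" for j i
    using dt_pos by (simp add: len_nonneg lam_def)
  have s_nonneg: "0 \<le> (norm (vc x j - vc x (j - 1)))\<^sup>2 / len j" for j
    by (simp add: len_nonneg)
  have stiff: "stiff (vc x) (vc x) = real J * (\<Sum>j=1..J. (norm (vc x j - vc x (j - 1)))\<^sup>2 / len j)"
    by (simp add: stiff_def power2_norm_eq_inner)
  have "0 \<le> stiff (vc x) (vc x)"
    unfolding stiff using s_nonneg by (intro mult_nonneg_nonneg sum_nonneg) auto
  with energy trapezoid_nonneg [of ?e J] e_nonneg
  have e0: "trapezoid J ?e = 0" and s0: "stiff (vc x) (vc x) = 0" by fastforce+
  have \<kappa>0: "nc x 0 i = 0" if "i \<le> J" for i
  proof (cases "i = 0")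
    case True
    have one: "1 \<in> {1..J}" using J_pos by simp
    from trapezoid_eq_0D(2) [OF J_pos e0 e_nonneg one] show ?thesis
      using True dt_pos len_nonzero [OF one] by (simp add: lam_def split: if_splits)
  next
    case False
    then have i: "i \<in> {1..J}" using that by simp
    from trapezoid_eq_0D(1) [OF J_pos e0 e_nonneg i] show ?thesis
      using dt_pos len_nonzero [OF i] by (simp add: lam_def split: if_splits)
  qed
  have step: "vc x j = vc x (j - 1)" if "j \<in> {1..J}" for j
  proof -
    have "(\<Sum>j=1..J. (norm (vc x j - vc x (j - 1)))\<^sup>2 / len j) = 0"
      using s0 J_pos by (simp add: stiff)
    then have "(norm (vc x j - vc x (j - 1)))\<^sup>2 / len j = 0"
      using s_nonneg that by (subst (asm) sum_nonneg_eq_0_iff) auto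
    then show ?thesis using len_nonzero [OF that] by simp
  qed
  have const: "vc x j = vc x 0" if "j \<le> J" for j
    using that
  proof (induction j)
    case (Suc j)
    then show ?case using step [of "Suc j"] by simp
  qed simp
  \<comment> \<open>As \<kappa> vanishes and the vector coefficients are constant, testing with the
    zero vector function and \<open>c\<close> leaves only the inner product of that constant with
    \<open>v\<close>, divided by \<open>dt\<close>.\<close>
  have orth: "orthogonal (vc x 0) v"
    if "v \<in> {lumped J (\<lambda>x. (c x * norm (drho X x)) *\<^sub>R nu X x) | c. c \<in> Vh per J}" for v
  proof -
    obtain c where c: "c \<in> Vh per J" "v = trapezoid J (\<lambda>j i. c (node J i) *\<^sub>R nrm j)"
      using \<open>v \<in> _\<close> lumped_normal by auto
    have zero: "(\<lambda>_. 0) \<in> VVh per J" by (auto simp: VVh_def Vh_def intro: exI [of _ 0])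
    obtain z where z: "z \<in> W" "represents per J z (\<lambda>_. 0) c"
      by (rule coefficients_exist [OF J_pos zero c(1), of constrained])
        (auto simp: nodal_def constrained_def)
    have z': "nc z 0 i = c (node J i)" "vc z i = 0" if "i \<le> J" for i
      using z(2) that by (simp_all add: represents_def)
    have "stiff (vc x) (vc z) = 0"
      unfolding stiff_def using step by simp
    moreover have "trapezoid J (\<lambda>j i. nc x 0 i * (nrm j \<bullet> vc z i)) = trapezoid J (\<lambda>j i. 0)"
      by (intro trapezoid_cong) (simp add: \<kappa>0)
    moreover have "trapezoid J (\<lambda>j i. nc z 0 i * ((vc x i \<bullet> nrm j) / dt - len j * (lam i * nc x 0 i)))
        = trapezoid J (\<lambda>j i. c (node J i) * ((vc x 0 \<bullet> nrm j) / dt))"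
    proof (rule trapezoid_cong)
      fix j i assume "i \<le> J"
      then show "nc z 0 i * ((vc x i \<bullet> nrm j) / dt - len j * (lam i * nc x 0 i))
          = c (node J i) * ((vc x 0 \<bullet> nrm j) / dt)"
        using const [of i] by (simp add: \<kappa>0 z')
    qed
    ultimately have "trapezoid J (\<lambda>j i. c (node J i) * ((vc x 0 \<bullet> nrm j) / dt)) = 0"
      using bspec [OF null z(1)] by (simp only: bform_def trapezoid_0 add_0_right)
    also have "trapezoid J (\<lambda>j i. c (node J i) * ((vc x 0 \<bullet> nrm j) / dt)) = (vc x 0 \<bullet> v) / dt"
      unfolding c(2) trapezoid_def
      by (simp add: inner_sum_right inner_add_right sum_divide_distrib add_divide_distrib mult_ac)
    finally show ?thesis using dt_pos by (simp add: orthogonal_def)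
  qed
  \<comment> \<open>Since the vectors \<open>v\<close> span the plane, the constant is orthogonal to
    itself.\<close>
  have "vc x 0 \<in> span {lumped J (\<lambda>x. (c x * norm (drho X x)) *\<^sub>R nu X x) | c. c \<in> Vh per J}"
    using spanning by (simp add: assmB_def)
  then have "orthogonal (vc x 0) (vc x 0)"
    using orth by (rule orthogonal_to_span)
  then have "vc x j = 0" if "j \<le> J" for j
    using const [OF that] by (simp add: orthogonal_self)
  with \<kappa>0 show ?thesis by (rule supported_zeroI [OF J_pos x])
qed

lemma coefficient_system_unique_solution: "\<exists>!x. x \<in> W \<and> (\<forall>y\<in>W. bform x y = lform y)"
proof (rule nondegenerate_bilinear_unique_solution [OF finite_dofs])
  show "linear_functional (\<lambda>x. bform x y)" "linear_functional (bform x)" "linear_functional lform" for x y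
    unfolding bform_def lform_def stiff_def by (intro linear_functional_intros)+
qed (use bform_nondegenerate in blast)

section \<open>Passage between functions and coefficients\<close>

abbreviation VB where "VB \<equiv> VVhB per J D P0 P1 P2"

lemma VB_represented:
  assumes "f \<in> VB" "\<kappa> \<in> Vh per J"
  obtains x where "x \<in> W" "represents per J x f \<kappa>"
proof (rule coefficients_exist [OF J_pos _ assms(2), of f constrained])
  show "f \<in> VVh per J" using assms by (simp add: VVhB_def VVh0_def)
  show "nodal J f \<kappa> j k = 0" if "(j, k) \<in> constrained" "j \<le> J" for j k
    using that assms(1)
    by (auto simp: constrained_def nodal_def VVhB_def VVh0_def e1_def e2_def inner_axis)
qed (use that in blast)

text \<open>Each boundary condition holds because the corresponding index at \<open>bnode p\<close>
  is missing from \<open>dofs\<close>. A boundary point exists only if \<open>per\<close> is false,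
  so no coefficient is redirected to \<open>J\<close>.\<close>

lemma W_represents:
  assumes "x \<in> W"
  obtains f \<kappa> where "f \<in> VB" "\<kappa> \<in> Vh per J" "represents per J x f \<kappa>"
proof -
  obtain f \<kappa> where f: "f \<in> VVh per J" "\<kappa> \<in> Vh per J" "represents per J x f \<kappa>"
    by (rule represents_exists [OF J_pos])
  have bc1: "f p $ 1 = 0" if p: "p \<in> D \<union> P0 \<union> P1" for p
  proof -
    have p': "p \<in> D \<union> P0 \<union> P1 \<union> P2" using p by blast
    have "(bnode p, 1) \<notin> dofs per J constrained"
      using p bnode(2) [OF p'] by (simp add: dofs_def constrained_def)
    then show ?thesis
      using assms represents_bdry [OF f(3) p'] bnode(1) [OF p']
      by (simp add: supported_on_def vcoef_def ncoef_def)
  qed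
  have bc2: "f p $ 2 = 0" if p: "p \<in> D \<union> P2" for p
  proof -
    have p': "p \<in> D \<union> P0 \<union> P1 \<union> P2" using p by blast
    have "(bnode p, 2) \<notin> dofs per J constrained"
      using p bnode(2) [OF p'] by (simp add: dofs_def constrained_def)
    then show ?thesis
      using assms represents_bdry [OF f(3) p'] bnode(1) [OF p']
      by (simp add: supported_on_def vcoef_def ncoef_def)
  qed
  have "f \<in> VB"
    using f(1) bc1 bc2
    by (auto simp: VVhB_def VVh0_def e1_def e2_def inner_axis vec_eq_iff forall_2)
  then show thesis using f that by blast
qed

definition eq_velocity :: "(real \<Rightarrow> real^2) \<Rightarrow> (real \<Rightarrow> real) \<Rightarrow> (real \<Rightarrow> real) \<Rightarrow> bool" where
  "eq_velocity dX \<kappa> chi \<longleftrightarrow>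
          lumped J (\<lambda>x. ((1 / dt) *\<^sub>R ((X x + dX x) - X x))
                          \<bullet> ((chi x * norm (drho X x)) *\<^sub>R nu X x))
          = lumped J (\<lambda>x. (\<kappa> x - Kop per J P0 X \<kappa> x) * (chi x * norm (drho X x)))"

definition eq_curvature :: "(real \<Rightarrow> real^2) \<Rightarrow> (real \<Rightarrow> real) \<Rightarrow> (real \<Rightarrow> real^2) \<Rightarrow> bool" where
  "eq_curvature dX \<kappa> \<eta> \<longleftrightarrow>
          lumped J (\<lambda>x. (\<kappa> x *\<^sub>R nu X x) \<bullet> (norm (drho X x) *\<^sub>R \<eta> x))
          + L2 (\<lambda>x. drho (\<lambda>y. X y + dX y) x \<bullet> ((1 / norm (drho X x)) *\<^sub>R drho \<eta> x))
          = - ((\<Sum>p\<in>P1. rhohat p * (\<eta> p \<bullet> e2)) + (\<Sum>p\<in>P2. rhohat p * (\<eta> p \<bullet> e1)))"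

lemma eq_velocity_nodal:
  assumes "dX \<in> VVh per J" "\<kappa> \<in> Vh per J" "chi \<in> Vh per J"
    "represents per J x dX \<kappa>" "represents per J y \<eta> chi"
  shows "eq_velocity dX \<kappa> chi \<longleftrightarrow>
    trapezoid J (\<lambda>j i. nc y 0 i * ((vc x i \<bullet> nrm j) / dt - len j * (lam i * nc x 0 i)))
    = trapezoid J (\<lambda>j i. nc y 0 i * (- (len j * src i)))"
proof -
  have P0: "per \<longrightarrow> P0 = {}" using bdry_subset by blast
  note K = Kop_fe [OF assms(2) P0]
  have 1: "trapezoid J (\<lambda>j i. chi (node J i) * ((dX (node J i) \<bullet> nrm j) / dt))
      = trapezoid J (\<lambda>j i. nc y 0 i * ((vc x i \<bullet> nrm j) / dt))"
    by (intro trapezoid_cong) (use assms(4,5) in \<open>simp add: represents_def\<close>)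
  have 2: "trapezoid J (\<lambda>j i. chi (node J i) * (len j * (\<kappa> (node J i) - Kop per J P0 X \<kappa> (node J i))))
      = trapezoid J (\<lambda>j i. nc y 0 i * (len j * (lam i * nc x 0 i)) + nc y 0 i * (- (len j * src i)))"
    by (intro trapezoid_cong)
      (use assms(4,5) K(2) in \<open>simp add: represents_def lam_def src_def algebra_simps\<close>)
  show ?thesis
    unfolding eq_velocity_def lumped_velocity [OF assms(1,3)]
      lumped_curvature [OF assms(2) K(1) assms(3)] 1 2
    unfolding right_diff_distrib trapezoid_diff trapezoid_add by linarith
qed

text \<open>The stiffness term is linear in \<open>X + dX\<close>; the contribution of the known
  curve \<open>X\<close> moves to the right-hand side.\<close>

lemma eq_curvature_nodal:
  assumes "dX \<in> VVh per J" "\<kappa> \<in> Vh per J" "\<eta> \<in> VVh per J"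
    "represents per J x dX \<kappa>" "represents per J y \<eta> chi"
  shows "eq_curvature dX \<kappa> \<eta> \<longleftrightarrow>
    trapezoid J (\<lambda>j i. nc x 0 i * (nrm j \<bullet> vc y i)) + stiff (vc x) (vc y)
    = - (stiff (\<lambda>j. X (node J j)) (vc y)
        + ((\<Sum>p\<in>P1. rhohat p * (vc y (bnode p) \<bullet> e2)) + (\<Sum>p\<in>P2. rhohat p * (vc y (bnode p) \<bullet> e1))))"
proof -
  have 1: "trapezoid J (\<lambda>j i. \<kappa> (node J i) * (nrm j \<bullet> \<eta> (node J i)))
      = trapezoid J (\<lambda>j i. nc x 0 i * (nrm j \<bullet> vc y i))"
    by (intro trapezoid_cong) (use assms(4,5) in \<open>simp add: represents_def\<close>)
  have 2: "L2 (\<lambda>x. drho (\<lambda>y. X y + dX y) x \<bullet> ((1 / norm (drho X x)) *\<^sub>R drho \<eta> x))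
      = stiff (\<lambda>j. X (node J j)) (vc y) + stiff (vc x) (vc y)"
  proof -
    have split: "(X (node J j) + dX (node J j)) - (X (node J (j - 1)) + dX (node J (j - 1)))
        = (X (node J j) - X (node J (j - 1))) + (vc x j - vc x (j - 1))"
      and test: "\<eta> (node J j) - \<eta> (node J (j - 1)) = vc y j - vc y (j - 1)" if "j \<in> {1..J}" for j
      using assms(4,5) that le_trans [OF diff_le_self, of j J 1] by (simp_all add: represents_def)
    show ?thesis
      unfolding L2_stiffness [OF VVh_add [OF X_fe assms(1)] assms(3)] stiff_def
        distrib_left [symmetric] sum.distrib [symmetric] add_divide_distrib [symmetric]
        inner_add_left [symmetric]
      by (intro arg_cong [of _ _ "(*) (real J)"] sum.cong refl) (simp only: split test)
  qed
  have 3: "\<eta> p = vc y (bnode p)" if "p \<in> P1 \<union> P2" for p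
    using represents_bdry [OF assms(5)] that by blast
  show ?thesis
    unfolding eq_curvature_def lumped_curvature_vector [OF assms(2,3)] 1 2
    by (simp add: 3) linarith
qed

lemma equations_iff_coefficient_system:
  assumes dX: "dX \<in> VB" and \<kappa>: "\<kappa> \<in> Vh per J" and x: "represents per J x dX \<kappa>"
  shows "(\<forall>chi\<in>Vh per J. eq_velocity dX \<kappa> chi) \<and> (\<forall>\<eta>\<in>VB. eq_curvature dX \<kappa> \<eta>)
    \<longleftrightarrow> (\<forall>y\<in>W. bform x y = lform y)"
proof -
  have VB_VVh: "f \<in> VVh per J" if "f \<in> VB" for f
    using that by (simp add: VVhB_def VVh0_def)
  note vel = eq_velocity_nodal [OF VB_VVh [OF dX] \<kappa> _ x]
    and cur = eq_curvature_nodal [OF VB_VVh [OF dX] \<kappa> _ x]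
  have zero: "(\<lambda>_. 0) \<in> VB" "(\<lambda>_. 0) \<in> Vh per J"
    by (auto simp: VVhB_def VVh0_def VVh_def Vh_def intro: exI [of _ 0])
  show ?thesis
  proof safe
    fix y assume eqs: "\<forall>chi\<in>Vh per J. eq_velocity dX \<kappa> chi" "\<forall>\<eta>\<in>VB. eq_curvature dX \<kappa> \<eta>"
      and "y \<in> W"
    then obtain \<eta> chi where y: "\<eta> \<in> VB" "chi \<in> Vh per J" "represents per J y \<eta> chi"
      using W_represents by blast
    show "bform x y = lform y"
      using eqs y vel [OF y(2,3)] cur [OF VB_VVh [OF y(1)] y(3)]
      by (simp add: bform_def lform_def)
  next
    fix chi assume sys: "\<forall>y\<in>W. bform x y = lform y" and chi: "chi \<in> Vh per J"
    obtain y where y: "y \<in> W" "represents per J y (\<lambda>_. 0) chi"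
      using VB_represented [OF zero(1) chi] by blast
    \<comment> \<open>For the zero vector test function both sides of the second equation vanish.
      Cancelling it from the summed identity isolates the first equation.\<close>
    have "vc (\<lambda>_. 0) j = 0" for j
      by (simp add: vcoef_def ncoef_def vec_eq_iff forall_2)
    moreover from this have "represents per J (\<lambda>_. 0) (\<lambda>_. 0) (\<lambda>_. 0)"
      by (simp add: represents_def ncoef_def)
    ultimately have "eq_curvature dX \<kappa> (\<lambda>_. 0)"
      using cur [OF VB_VVh [OF zero(1)]] by (simp add: stiff_def)
    then show "eq_velocity dX \<kappa> chi"
      using bspec [OF sys y(1)] unfolding vel [OF chi y(2)] cur [OF VB_VVh [OF zero(1)] y(2)]
        bform_def lform_def by (simp only: mult_minus1 add_left_cancel add_right_cancel)
  next
    fix \<eta> assume sys: "\<forall>y\<in>W. bform x y = lform y" and \<eta>: "\<eta> \<in> VB"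
    obtain y where y: "y \<in> W" "represents per J y \<eta> (\<lambda>_. 0)"
      using VB_represented [OF \<eta> zero(2)] by blast
    \<comment> \<open>Here the first equation is cancelled: with a zero test function both lumped
      integrands are identically zero.\<close>
    have "eq_velocity dX \<kappa> (\<lambda>_. 0)"
      unfolding eq_velocity_def by simp
    then show "eq_curvature dX \<kappa> \<eta>"
      using bspec [OF sys y(1)] unfolding vel [OF zero(2) y(2)] cur [OF VB_VVh [OF \<eta>] y(2)]
        bform_def lform_def by (simp only: mult_minus1 add_left_cancel add_right_cancel)
  qed
qed

theorem unique_solution:
  "\<exists>!p. case p of (dX, \<kappa>) \<Rightarrow> dX \<in> VB \<and> \<kappa> \<in> Vh per J \<and>
    (\<forall>chi\<in>Vh per J. eq_velocity dX \<kappa> chi) \<and> (\<forall>\<eta>\<in>VB. eq_curvature dX \<kappa> \<eta>)"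
proof -
  obtain x where x: "x \<in> W" "\<forall>y\<in>W. bform x y = lform y"
    and unique: "\<And>z. z \<in> W \<Longrightarrow> \<forall>y\<in>W. bform z y = lform y \<Longrightarrow> z = x"
    using coefficient_system_unique_solution by blast
  obtain dX \<kappa> where sol: "dX \<in> VB" "\<kappa> \<in> Vh per J" "represents per J x dX \<kappa>"
    by (rule W_represents [OF x(1)])
  show ?thesis
  proof (rule ex1I [of _ "(dX, \<kappa>)"], simp_all only: prod.case)
    show "dX \<in> VB \<and> \<kappa> \<in> Vh per J \<and>
      (\<forall>chi\<in>Vh per J. eq_velocity dX \<kappa> chi) \<and> (\<forall>\<eta>\<in>VB. eq_curvature dX \<kappa> \<eta>)"
      using sol x equations_iff_coefficient_system [OF sol] by blast
    fix p
    assume "case p of (dX', \<kappa>') \<Rightarrow> dX' \<in> VB \<and> \<kappa>' \<in> Vh per J \<and>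
      (\<forall>chi\<in>Vh per J. eq_velocity dX' \<kappa>' chi) \<and> (\<forall>\<eta>\<in>VB. eq_curvature dX' \<kappa>' \<eta>)"
    then obtain dX' \<kappa>' where p: "p = (dX', \<kappa>')" "dX' \<in> VB" "\<kappa>' \<in> Vh per J"
      and eqs: "(\<forall>chi\<in>Vh per J. eq_velocity dX' \<kappa>' chi) \<and> (\<forall>\<eta>\<in>VB. eq_curvature dX' \<kappa>' \<eta>)"
      by (cases p) auto
    obtain z where z: "z \<in> W" "represents per J z dX' \<kappa>'"
      by (rule VB_represented [OF p(2,3)])
    then have "z = x"
      using unique equations_iff_coefficient_system [OF p(2,3) z(2)] eqs by blast
    \<comment> \<open>Equal coefficients give equal nodal values, and these determine discrete
      functions, also outside the unit interval, where they vanish by convention.\<close>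
    then have nodes: "dX' (node J j) = dX (node J j)" "\<kappa>' (node J j) = \<kappa> (node J j)" if "j \<le> J" for j
      using z(2) sol(3) that by (simp_all add: represents_def)
    have "dX' = dX"
      using p(2) sol(1) nodes by (intro VVh_eqI [OF _ _ J_pos]) (auto simp: VVhB_def VVh0_def)
    moreover have "\<kappa>' = \<kappa>"
      using p(3) sol(2) nodes by (intro Vh_eqI [OF _ _ J_pos]) auto
    ultimately show "p = (dX, \<kappa>)" using p(1) by simp
  qed
qed

end

text \<open>A vanishing slope makes the derivative zero on a nonempty open interval, which is not
  negligible. Positivity almost everywhere therefore holds on every element, as the divisions by
  \<open>len j\<close> require.\<close>

lemma assmA_slope_nonzero:
  assumes "0 < J" and X: "X \<in> VVh per J" and A: "assmA per P0 X" and j: "j \<in> {1..J}"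
  shows "slope J X j \<noteq> 0"
proof
  assume zero: "slope J X j = 0"
  have less: "node J (j - 1) < node J j" using node_less assms(1) j by simp
  have "{node J (j - 1)<..<node J j} \<subseteq> {x \<in> {0<..<1}. \<not> norm (drho X x) > 0}"
  proof
    fix x assume x: "x \<in> {node J (j - 1)<..<node J j}"
    have "0 \<le> node J (j - 1)" "node J j \<le> 1"
      using node_in_unit [OF assms(1)] j by auto
    then show "x \<in> {x \<in> {0<..<1}. \<not> norm (drho X x) > 0}"
      using x drho_element [OF X assms(1) j x] zero by auto
  qed
  then have "negligible {node J (j - 1)<..<node J j}"
    using A negligible_subset unfolding assmA_def by blast
  then show False
    using open_not_negligible [of "{node J (j - 1)<..<node J j}"] less by simp
qed

theorem lemma4p1:
  fixes per :: bool and J :: nat and D P0 P1 P2 :: "real set"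
    and rhohat :: "real \<Rightarrow> real" and X :: "real \<Rightarrow> real^2" and dt :: real
  assumes J3: "J \<ge> 3"
    and part: "D \<union> P0 \<union> P1 \<union> P2 = bdryI per"
    and disj: "D \<inter> P0 = {}" "D \<inter> P1 = {}" "D \<inter> P2 = {}"
              "P0 \<inter> P1 = {}" "P0 \<inter> P2 = {}" "P1 \<inter> P2 = {}"
    and rho_bd: "\<forall>p\<in>{0, 1}. \<bar>rhohat p\<bar> \<le> 1"
    and XV: "X \<in> VVh0 per J P0"
    and A: "assmA per P0 X"
    and B: "assmB per J X"
    and dt: "dt > 0"
  shows "\<exists>!p :: (real \<Rightarrow> real^2) \<times> (real \<Rightarrow> real).
     case p of (dX, \<kappa>) \<Rightarrow>
       dX \<in> VVhB per J D P0 P1 P2 \<and> \<kappa> \<in> Vh per J \<and>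
       (\<forall>chi\<in>Vh per J.
          lumped J (\<lambda>x. ((1 / dt) *\<^sub>R ((X x + dX x) - X x))
                          \<bullet> ((chi x * norm (drho X x)) *\<^sub>R nu X x))
          = lumped J (\<lambda>x. (\<kappa> x - Kop per J P0 X \<kappa> x) * (chi x * norm (drho X x)))) \<and>
       (\<forall>\<eta>\<in>VVhB per J D P0 P1 P2.
          lumped J (\<lambda>x. (\<kappa> x *\<^sub>R nu X x) \<bullet> (norm (drho X x) *\<^sub>R \<eta> x))
          + L2 (\<lambda>x. drho (\<lambda>y. X y + dX y) x \<bullet> ((1 / norm (drho X x)) *\<^sub>R drho \<eta> x))
          = - ((\<Sum>p\<in>P1. rhohat p * (\<eta> p \<bullet> e2)) + (\<Sum>p\<in>P2. rhohat p * (\<eta> p \<bullet> e1))))"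
proof -
  have J: "0 < J" using J3 by simp
  have X: "X \<in> VVh per J" using XV by (simp add: VVh0_def)
  interpret fe_scheme per J X D P0 P1 P2 rhohat dt
    using J X part B dt assmA_slope_nonzero [OF J X A] by unfold_locales auto
  show ?thesis
    using unique_solution unfolding eq_velocity_def eq_curvature_def .
qed

end
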